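(* Let $\varepsilon>0$ be arbitrarily small. Then there exists $n_\varepsilon$ such that for all $n\ge n_\varepsilon$ the following holds for the strong connectivity game with bias $b$ on the complete digraph $\vec{K}_n$: Breaker wins (has a winning strategy) if $b\geq \frac{(1+\varepsilon)n}{\log n}$, and Maker wins (has a winning strategy) if $b\leq \frac{(1-\varepsilon)n}{\log n}$.
   Context: $\vec{K}_n$ is the complete digraph on vertex set $[n]=\{1,\dots,n\}$, containing every ordered pair $(i,j)$ with $i\ne j$ as an edge. In a biased Maker-Breaker game on $\vec{K}_n$ with bias $b$ (a positive integer), the players alternately claim previously unclaimed edges of $\vec{K}_n$. Maker goes first and claims one edge on each of her turns; Breaker claims $b$ edges on each of his turns. Play continues until there are no edges left to take (the last move may be partial), and the sets of edges claimed by the two players are disjoint. Let $D_M$ be the digraph with vertex set $[n]$ whose edges are those claimed by Maker. In the strong connectivity game, Maker wins if on termination $D_M$ is strongly connected; otherwise Breaker wins. "Maker wins" (respectively "Breaker wins") for a given $n$ and $b$ means that this player has a strategy that wins against every strategy of the opponent. $\log$ is the natural logarithm. *)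

theory Defs
  imports Complex_Main "Graph_Theory.Digraph_Component"
begin

section \<open>Biased Maker-Breaker games on a finite board\<close>

text \<open>
  A history is the list of moves made so far, a move being the set of elements claimed in one turn.
  Maker makes the moves with even index (counted from 0), Breaker those with odd index.
\<close>

type_synonym 'e history = "'e set list"
type_synonym 'e strategy = "'e history \<Rightarrow> 'e set"

definition unclaimed :: "'e set \<Rightarrow> 'e history \<Rightarrow> 'e set" where
  "unclaimed E h = E - \<Union>(set h)"

text \<open>The minimum allows a partial last move, when fewer than \<open>q\<close> elements are left.\<close>

definition legal_move :: "'e set \<Rightarrow> nat \<Rightarrow> 'e history \<Rightarrow> 'e set \<Rightarrow> bool" where
  "legal_move E q h X \<longleftrightarrow> X \<subseteq> unclaimed E h \<and> card X = min q (card (unclaimed E h))"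

text \<open>
  Legality is required at every list of sets, including those that no play produces. On a finite
  board this is no restriction: a legal move always exists, and the values at such lists are never
  used.
\<close>

definition legal_strategy :: "'e set \<Rightarrow> nat \<Rightarrow> 'e strategy \<Rightarrow> bool" where
  "legal_strategy E q s \<longleftrightarrow> (\<forall>h. legal_move E q h (s h))"

primrec play :: "'e strategy \<Rightarrow> 'e strategy \<Rightarrow> nat \<Rightarrow> 'e history" where
  "play \<sigma> \<tau> 0 = []"
| "play \<sigma> \<tau> (Suc k) =
     play \<sigma> \<tau> k @ [if even k then \<sigma> (play \<sigma> \<tau> k) else \<tau> (play \<sigma> \<tau> k)]"

text \<open>The least number below exists for legal strategies, by \<open>play_terminates\<close>.\<close>

definition final_play :: "'e set \<Rightarrow> 'e strategy \<Rightarrow> 'e strategy \<Rightarrow> 'e history" where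
  "final_play E \<sigma> \<tau> = play \<sigma> \<tau> (LEAST k. unclaimed E (play \<sigma> \<tau> k) = {})"

definition maker_claims :: "'e history \<Rightarrow> 'e set" where
  "maker_claims h = (\<Union>i\<in>{i. i < length h \<and> even i}. h ! i)"

text \<open>The predicate \<open>W\<close> says which final sets of Maker are winning for her.\<close>

definition maker_wins :: "'e set \<Rightarrow> nat \<Rightarrow> ('e set \<Rightarrow> bool) \<Rightarrow> bool" where
  "maker_wins E b W \<longleftrightarrow>
     (\<exists>\<sigma>. legal_strategy E 1 \<sigma> \<and>
       (\<forall>\<tau>. legal_strategy E b \<tau> \<longrightarrow> W (maker_claims (final_play E \<sigma> \<tau>))))"

definition breaker_wins :: "'e set \<Rightarrow> nat \<Rightarrow> ('e set \<Rightarrow> bool) \<Rightarrow> bool" where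
  "breaker_wins E b W \<longleftrightarrow>
     (\<exists>\<tau>. legal_strategy E b \<tau> \<and>
       (\<forall>\<sigma>. legal_strategy E 1 \<sigma> \<longrightarrow> \<not> W (maker_claims (final_play E \<sigma> \<tau>))))"

lemma legal_strategy_exists:
  assumes "finite E"
  shows "\<exists>s. legal_strategy E q s"
proof -
  have "\<exists>X. legal_move E q h X" for h
  proof -
    obtain X where "X \<subseteq> unclaimed E h" "card X = min q (card (unclaimed E h))"
      by (meson min.cobounded2 obtain_subset_with_card_n)
    then show ?thesis
      unfolding legal_move_def by blast
  qed
  then show ?thesis
    unfolding legal_strategy_def by metis
qed

lemma play_terminates:
  assumes "finite E" "b \<ge> 1" "legal_strategy E 1 \<sigma>" "legal_strategy E b \<tau>"
  shows "\<exists>k. unclaimed E (play \<sigma> \<tau> k) = {}"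
proof -
  have "card (unclaimed E (play \<sigma> \<tau> k)) \<le> card E - k" for k
  proof (induction k)
    case 0
    then show ?case by (simp add: unclaimed_def)
  next
    case (Suc k)
    let ?U = "unclaimed E (play \<sigma> \<tau> k)"
    define X where "X = (if even k then \<sigma> (play \<sigma> \<tau> k) else \<tau> (play \<sigma> \<tau> k))"
    have fin: "finite ?U"
      using assms(1) by (simp add: unclaimed_def)
    have X: "X \<subseteq> ?U" "card X \<ge> min 1 (card ?U)"
      using assms(2-4) unfolding X_def legal_strategy_def legal_move_def by auto
    have "unclaimed E (play \<sigma> \<tau> (Suc k)) = ?U - X"
      by (auto simp: unclaimed_def X_def)
    then have "card (unclaimed E (play \<sigma> \<tau> (Suc k))) = card ?U - card X"
      using X(1) fin by (simp add: card_Diff_subset finite_subset)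
    then show ?case
      using Suc X(2) by linarith
  qed
  from this[of "card E"] have "card (unclaimed E (play \<sigma> \<tau> (card E))) = 0"
    by simp
  then show ?thesis
    using assms(1) by (metis card_0_eq finite_Diff unclaimed_def)
qed


section \<open>The strong connectivity game\<close>

definition complete_digraph_edges :: "nat \<Rightarrow> (nat \<times> nat) set" where
  "complete_digraph_edges n = {(i, j). i \<in> {1..n} \<and> j \<in> {1..n} \<and> i \<noteq> j}"

definition digraph_on :: "nat \<Rightarrow> (nat \<times> nat) set \<Rightarrow> (nat, nat \<times> nat) pre_digraph" where
  "digraph_on n A = with_proj \<lparr> pverts = {1..n}, parcs = A \<rparr>"

definition maker_wins_strong_connectivity :: "nat \<Rightarrow> nat \<Rightarrow> bool" where
  "maker_wins_strong_connectivity n b \<longleftrightarrow>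
     maker_wins (complete_digraph_edges n) b (\<lambda>A. strongly_connected (digraph_on n A))"

definition breaker_wins_strong_connectivity :: "nat \<Rightarrow> nat \<Rightarrow> bool" where
  "breaker_wins_strong_connectivity n b \<longleftrightarrow>
     breaker_wins (complete_digraph_edges n) b (\<lambda>A. strongly_connected (digraph_on n A))"

end

theory Submission
  imports Defs "HOL-Analysis.Harmonic_Numbers" "HOL-Real_Asymp.Real_Asymp"
begin

text \<open>
  Breaker plays a box game on the \<open>n\<close> disjoint out-stars. Keeping all out-stars untouched by
  Maker at the same level, he fills one of them as soon as
  \<open>\<Sum>i<n. b div i \<ge> n - 1\<close>, and this sum is at least \<open>b ln b - b\<close>.

  Maker treats the \<open>2 n\<close> in-stars and out-stars one by one, always the one on which Breaker has
  spent most. An edge lies in an in-star and an out-star, which at first sight costs a factor 2 in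
  the bias. But a set of \<open>j\<close> stars has few common edges when \<open>j\<close> is at most about
  \<open>n / ln n\<close>, and the larger sets contribute only \<open>O(b ln ln n)\<close>; averaging over the stars that
  are treated last bounds the number of edges Breaker can spend on an untreated star by
  \<open>b ln n + o(n)\<close> plus a small multiple of \<open>n\<close>.

  While no star is in danger Maker grows two cores of linear size, one reachable from the vertex 1
  and one reaching it. Treating the in-star of \<open>v\<close> means joining \<open>v\<close> to the first core. If Breaker
  owns all edges from this core to \<open>v\<close>, then \<open>v\<close> is deferred: it gets an edge from some vertex
  that is not deferred yet. Breaker can afford only \<open>o(n)\<close> such vertices, so the edge exists, and
  following these edges backwards one never returns to a vertex deferred earlier, hence arrives at
  the core. Out-stars are treated symmetrically.
\<close>

section \<open>Winning by positional invariants\<close>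

definition breaker_claims :: "'e history \<Rightarrow> 'e set" where
  "breaker_claims h = (\<Union>i\<in>{i. i < length h \<and> odd i}. h ! i)"

lemma length_play [simp]: "length (play \<sigma> \<tau> k) = k"
  by (induction k) auto

lemma maker_claims_snoc:
  "maker_claims (h @ [X]) = (if even (length h) then maker_claims h \<union> X else maker_claims h)"
proof -
  have "{i. i < length (h @ [X]) \<and> even i} =
        {i. i < length h \<and> even i} \<union> (if even (length h) then {length h} else {})"
    by (auto simp: less_Suc_eq)
  then show ?thesis
    unfolding maker_claims_def by (auto simp: nth_append)
qed

lemma breaker_claims_snoc:
  "breaker_claims (h @ [X]) = (if even (length h) then breaker_claims h else breaker_claims h \<union> X)"
proof -
  have "{i. i < length (h @ [X]) \<and> odd i} =
        {i. i < length h \<and> odd i} \<union> (if odd (length h) then {length h} else {})"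
    by (auto simp: less_Suc_eq)
  then show ?thesis
    unfolding breaker_claims_def by (auto simp: nth_append)
qed

lemma claims_Nil [simp]: "maker_claims [] = {}" "breaker_claims [] = {}"
  by (auto simp: maker_claims_def breaker_claims_def)

lemma unclaimed_eq: "unclaimed E h = E - (maker_claims h \<union> breaker_claims h)"
proof -
  have "\<Union>(set h) = maker_claims h \<union> breaker_claims h"
    unfolding maker_claims_def breaker_claims_def set_conv_nth by blast
  then show ?thesis
    by (simp add: unclaimed_def)
qed

text \<open>An invariant that holds whenever Maker is to move also holds at the end, even if the
  board is exhausted by a move of Maker, because Breaker's next move is then empty.\<close>

lemma final_play_invariant:
  assumes "finite E" "b \<ge> 1" "legal_strategy E 1 \<sigma>" "legal_strategy E b \<tau>"
    and inv: "\<And>m. I (maker_claims (play \<sigma> \<tau> (2 * m))) (breaker_claims (play \<sigma> \<tau> (2 * m)))"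
  obtains B where "I (maker_claims (final_play E \<sigma> \<tau>)) B"
    "E \<subseteq> maker_claims (final_play E \<sigma> \<tau>) \<union> B"
proof -
  define K where "K = (LEAST k. unclaimed E (play \<sigma> \<tau> k) = {})"
  have fp: "final_play E \<sigma> \<tau> = play \<sigma> \<tau> K"
    by (simp add: final_play_def K_def)
  have "unclaimed E (play \<sigma> \<tau> K) = {}"
    unfolding K_def by (rule LeastI_ex) (use play_terminates[OF assms(1-4)] in blast)
  then have empty: "E \<subseteq> maker_claims (play \<sigma> \<tau> K) \<union> breaker_claims (play \<sigma> \<tau> K)"
    by (auto simp: unclaimed_eq)
  show thesis
  proof (cases "even K")
    case True
    then obtain m where "K = 2 * m" by blast
    then show ?thesis
      using that[of "breaker_claims (play \<sigma> \<tau> K)"] inv[of m] empty fp by simp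
  next
    case False
    then obtain m where m: "Suc K = 2 * m"
      by (metis even_Suc evenE)
    have "maker_claims (play \<sigma> \<tau> (Suc K)) = maker_claims (play \<sigma> \<tau> K)"
      "breaker_claims (play \<sigma> \<tau> K) \<subseteq> breaker_claims (play \<sigma> \<tau> (Suc K))"
      using False by (auto simp: maker_claims_snoc breaker_claims_snoc)
    then show ?thesis
      using that[of "breaker_claims (play \<sigma> \<tau> (Suc K))"] inv[of m] empty fp m by auto
  qed
qed

lemma maker_wins_by_invariant:
  assumes "finite E" "b \<ge> 1"
    and init: "I {} {}"
    and step: "\<And>M B. I M B \<Longrightarrow> E - (M \<union> B) \<noteq> {} \<Longrightarrow>
      \<exists>e\<in>E - (M \<union> B). \<forall>X. X \<subseteq> E - (M \<union> B) - {e} \<and> card X \<le> b \<longrightarrow> I (insert e M) (B \<union> X)"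
    and final: "\<And>M B. I M B \<Longrightarrow> E \<subseteq> M \<union> B \<Longrightarrow> W M"
  shows "maker_wins E b W"
proof -
  define good where "good M B e \<longleftrightarrow> e \<in> E - (M \<union> B) \<and>
    (\<forall>X. X \<subseteq> E - (M \<union> B) - {e} \<and> card X \<le> b \<longrightarrow> I (insert e M) (B \<union> X))" for M B e
  \<comment> \<open>\<open>legal_strategy\<close> quantifies over all histories, also those where
    the invariant fails; there the choice falls back to an arbitrary unclaimed edge.\<close>
  define \<sigma> where "\<sigma> h = (if unclaimed E h = {} then {} else
    {SOME e. e \<in> unclaimed E h \<and>
      ((\<exists>e. good (maker_claims h) (breaker_claims h) e) \<longrightarrow>
        good (maker_claims h) (breaker_claims h) e)})" for h
  have \<sigma>: "\<exists>e. \<sigma> h = {e} \<and> e \<in> unclaimed E h \<and>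
      ((\<exists>e. good (maker_claims h) (breaker_claims h) e) \<longrightarrow>
        good (maker_claims h) (breaker_claims h) e)" if "unclaimed E h \<noteq> {}" for h
  proof -
    have "\<exists>e. e \<in> unclaimed E h \<and>
      ((\<exists>e. good (maker_claims h) (breaker_claims h) e) \<longrightarrow>
        good (maker_claims h) (breaker_claims h) e)"
      using that by (auto simp: good_def unclaimed_eq)
    from someI_ex[OF this] show ?thesis
      using that by (auto simp: \<sigma>_def)
  qed
  have legal: "legal_strategy E 1 \<sigma>"
    unfolding legal_strategy_def legal_move_def
  proof
    fix h
    have fin: "finite (unclaimed E h)"
      using assms(1) by (simp add: unclaimed_def)
    show "\<sigma> h \<subseteq> unclaimed E h \<and> card (\<sigma> h) = min 1 (card (unclaimed E h))"
    proof (cases "unclaimed E h = {}")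
      case False
      then have "card (unclaimed E h) > 0"
        using fin by (simp add: card_gt_0_iff)
      with \<sigma>[OF False] show ?thesis by auto
    qed (auto simp: \<sigma>_def)
  qed
  have "W (maker_claims (final_play E \<sigma> \<tau>))" if \<tau>: "legal_strategy E b \<tau>" for \<tau>
  proof -
    have inv: "I (maker_claims (play \<sigma> \<tau> (2 * m))) (breaker_claims (play \<sigma> \<tau> (2 * m)))" for m
    proof (induction m)
      case 0
      then show ?case using init by simp
    next
      case (Suc m)
      define h where "h = play \<sigma> \<tau> (2 * m)"
      define h' where "h' = h @ [\<sigma> h]"
      have len: "length h = 2 * m"
        by (simp add: h_def)
      have next_h: "play \<sigma> \<tau> (2 * Suc m) = h' @ [\<tau> h']"
        by (simp add: h_def h'_def)
      have M: "maker_claims (play \<sigma> \<tau> (2 * Suc m)) = maker_claims h \<union> \<sigma> h"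
        and B: "breaker_claims (play \<sigma> \<tau> (2 * Suc m)) = breaker_claims h \<union> \<tau> h'"
        unfolding next_h using len
        by (simp_all add: h'_def maker_claims_snoc breaker_claims_snoc del: append_assoc)
      have IH: "I (maker_claims h) (breaker_claims h)"
        using Suc by (simp add: h_def)
      have \<tau>h': "\<tau> h' \<subseteq> unclaimed E h'" "card (\<tau> h') \<le> b"
        using \<tau> by (auto simp: legal_strategy_def legal_move_def)
      have un: "unclaimed E h' = unclaimed E h - \<sigma> h"
        by (auto simp: h'_def unclaimed_def)
      show ?case
      proof (cases "unclaimed E h = {}")
        case True
        then have "\<sigma> h = {}" "\<tau> h' = {}"
          using \<tau>h'(1) un by (auto simp: \<sigma>_def)
        then show ?thesis
          using IH M B by simp
      next
        case False
        have "\<exists>e. good (maker_claims h) (breaker_claims h) e"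
          using step[OF IH] False unfolding good_def unclaimed_eq by blast
        with \<sigma>[OF False] obtain e where e: "\<sigma> h = {e}" "good (maker_claims h) (breaker_claims h) e"
          by blast
        have "\<tau> h' \<subseteq> E - (maker_claims h \<union> breaker_claims h) - {e}"
          using \<tau>h'(1) un e(1) by (simp add: unclaimed_eq)
        then have "I (insert e (maker_claims h)) (breaker_claims h \<union> \<tau> h')"
          using e(2) \<tau>h'(2) unfolding good_def by blast
        then show ?thesis
          using M B e(1) by simp
      qed
    qed
    obtain B where "I (maker_claims (final_play E \<sigma> \<tau>)) B"
        "E \<subseteq> maker_claims (final_play E \<sigma> \<tau>) \<union> B"
      using final_play_invariant[OF assms(1,2) legal \<tau>, of I, OF inv] .
    then show ?thesis
      by (rule final)
  qed
  with legal show ?thesis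
    unfolding maker_wins_def by blast
qed

text \<open>A round again starts with Maker, so Breaker knows \<open>e\<close> when he picks
  \<open>X\<close>. His set is played as it stands, hence the exact size of a legal move in
  \<open>step\<close>.\<close>

lemma breaker_wins_by_invariant:
  assumes "finite E" "b \<ge> 1"
    and init: "I {} {}"
    and step: "\<And>M B e. I M B \<Longrightarrow> e \<in> E - (M \<union> B) \<Longrightarrow>
      \<exists>X \<subseteq> E - (M \<union> B) - {e}. card X = min b (card (E - (M \<union> B) - {e})) \<and> I (insert e M) (B \<union> X)"
    and final: "\<And>M B. I M B \<Longrightarrow> E \<subseteq> M \<union> B \<Longrightarrow> \<not> W M"
  shows "breaker_wins E b W"
proof -
  define good where "good h X \<longleftrightarrow> legal_move E b h X \<and>
    I (maker_claims h) (breaker_claims h \<union> X)" for h X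
  define \<tau> where "\<tau> h = (SOME X. legal_move E b h X \<and> ((\<exists>Y. good h Y) \<longrightarrow> good h X))" for h
  have \<tau>: "legal_move E b h (\<tau> h) \<and> ((\<exists>Y. good h Y) \<longrightarrow> good h (\<tau> h))" for h
  proof -
    have "\<exists>X. legal_move E b h X"
      using legal_strategy_exists[OF assms(1), of b] unfolding legal_strategy_def by blast
    then have "\<exists>X. legal_move E b h X \<and> ((\<exists>Y. good h Y) \<longrightarrow> good h X)"
      unfolding good_def by blast
    then show ?thesis
      unfolding \<tau>_def by (rule someI_ex)
  qed
  have legal: "legal_strategy E b \<tau>"
    unfolding legal_strategy_def using \<tau> by blast
  have "\<not> W (maker_claims (final_play E \<sigma> \<tau>))" if \<sigma>: "legal_strategy E 1 \<sigma>" for \<sigma>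
  proof -
    have inv: "I (maker_claims (play \<sigma> \<tau> (2 * m))) (breaker_claims (play \<sigma> \<tau> (2 * m)))" for m
    proof (induction m)
      case 0
      then show ?case using init by simp
    next
      case (Suc m)
      define h where "h = play \<sigma> \<tau> (2 * m)"
      define h' where "h' = h @ [\<sigma> h]"
      have len: "length h = 2 * m"
        by (simp add: h_def)
      have next_h: "play \<sigma> \<tau> (2 * Suc m) = h' @ [\<tau> h']"
        by (simp add: h_def h'_def)
      have M: "maker_claims (play \<sigma> \<tau> (2 * Suc m)) = maker_claims h \<union> \<sigma> h"
        and B: "breaker_claims (play \<sigma> \<tau> (2 * Suc m)) = breaker_claims h \<union> \<tau> h'"
        and M': "maker_claims h' = maker_claims h \<union> \<sigma> h"
        and B': "breaker_claims h' = breaker_claims h"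
        unfolding next_h using len
        by (simp_all add: h'_def maker_claims_snoc breaker_claims_snoc del: append_assoc)
      have IH: "I (maker_claims h) (breaker_claims h)"
        using Suc by (simp add: h_def)
      have \<sigma>h: "\<sigma> h \<subseteq> unclaimed E h" "card (\<sigma> h) = min 1 (card (unclaimed E h))"
        using \<sigma> by (auto simp: legal_strategy_def legal_move_def)
      have fin: "finite (unclaimed E h)"
        using assms(1) by (simp add: unclaimed_def)
      have un: "unclaimed E h' = unclaimed E h - \<sigma> h"
        by (auto simp: h'_def unclaimed_def)
      show ?case
      proof (cases "unclaimed E h = {}")
        case True
        then have "\<sigma> h = {}" "\<tau> h' = {}"
          using \<sigma>h(1) \<tau>[of h'] un by (auto simp: legal_move_def)
        then show ?thesis
          using IH M B by simp
      next
        case False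
        then have "card (\<sigma> h) = 1"
          using \<sigma>h(2) fin by (simp add: card_gt_0_iff Suc_le_eq min_def)
        then obtain e where e: "\<sigma> h = {e}"
          by (meson card_1_singletonE)
        have "\<exists>X. good h' X"
          using step[OF IH, of e] \<sigma>h(1) e
          unfolding good_def legal_move_def un M' B' by (auto simp: unclaimed_eq)
        then show ?thesis
          using \<tau>[of h'] unfolding good_def M B M' B' by blast
      qed
    qed
    obtain B where "I (maker_claims (final_play E \<sigma> \<tau>)) B"
        "E \<subseteq> maker_claims (final_play E \<sigma> \<tau>) \<union> B"
      using final_play_invariant[OF assms(1,2) \<sigma> legal, of I, OF inv] .
    then show ?thesis
      by (rule final)
  qed
  with legal show ?thesis
    unfolding breaker_wins_def by blast
qed

section \<open>Breaker isolates a vertex\<close>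

lemma finite_complete_digraph_edges [simp]: "finite (complete_digraph_edges n)"
  by (rule finite_subset[of _ "{1..n} \<times> {1..n}"]) (auto simp: complete_digraph_edges_def)

lemma not_strongly_connected_if_sink:
  assumes "n \<ge> 2" "v \<in> {1..n}" "\<And>w. (v, w) \<notin> M"
  shows "\<not> strongly_connected (digraph_on n M)"
proof
  assume sc: "strongly_connected (digraph_on n M)"
  obtain w where w: "w \<in> {1..n}" "w \<noteq> v"
    using assms(1,2) by (metis One_nat_def atLeastAtMost_iff le_add_same_cancel1 less_eq_Suc_le
        nat_le_linear numeral_2_eq_2 not_less_eq_eq)
  have "v \<rightarrow>\<^sup>*\<^bsub>digraph_on n M\<^esub> w"
    using sc w assms(2) unfolding strongly_connected_def digraph_on_def by simp
  then have "(v, w) \<in> M\<^sup>*"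
    by (drule_tac reachable_rtranclI) (simp add: digraph_on_def arcs_ends_def arc_to_ends_def)
  then show False
    using w(2) assms(3) by (auto elim: converse_rtranclE)
qed

lemma card_UN_le_mult:
  assumes "finite A" "\<And>x. x \<in> A \<Longrightarrow> card (F x) \<le> m"
  shows "card (\<Union>x\<in>A. F x) \<le> card A * m"
  by (rule order_trans[OF card_UN_le[OF assms(1)] sum_bounded_above[OF assms(2), simplified]])

text \<open>The invariant keeps a set \<open>L\<close> of vertices whose out-stars are free of
  Maker's edges and have at most \<open>\<rho> (card L)\<close> unclaimed edges each. Maker spoils
  at most one of them per turn. Breaker keeps \<open>s = card L - 1\<close> of the others and claims
  up to \<open>b div s\<close> edges in each, which is the difference between
  \<open>\<rho> (Suc s)\<close> and \<open>\<rho> s\<close>. As \<open>\<rho> 1 = 0\<close>, the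
  last out-star is entirely his.\<close>

lemma breaker_wins_box:
  fixes n b :: nat
  assumes n: "n \<ge> 2" and b: "b \<ge> 1" and box: "n - 1 \<le> (\<Sum>i=1..<n. b div i)"
  shows "breaker_wins_strong_connectivity n b"
proof -
  define E where "E = complete_digraph_edges n"
  define \<rho> where "\<rho> s = (\<Sum>i=1..<s. b div i)" for s
  define free where "free M B v = (E - (M \<union> B)) \<inter> {v} \<times> UNIV" for M B :: "(nat \<times> nat) set" and v
  define I where "I M B \<longleftrightarrow> (\<exists>L. L \<noteq> {} \<and> L \<subseteq> {1..n} \<and>
    (\<forall>v\<in>L. (\<forall>w. (v, w) \<notin> M) \<and> card (free M B v) \<le> \<rho> (card L)))" for M B
  have finE: "finite E"
    by (simp add: E_def)
  have fin_free: "finite (free M B v)" for M B v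
    using finE by (simp add: free_def)
  have free_mono: "card (free M' B' v) \<le> card (free M B v)" if "M \<union> B \<subseteq> M' \<union> B'" for M B M' B' v
    by (rule card_mono[OF fin_free]) (use that in \<open>auto simp: free_def\<close>)
  have "breaker_wins E b (\<lambda>A. strongly_connected (digraph_on n A))"
  proof (rule breaker_wins_by_invariant[where I = I, OF finE b])
    have "card (free {} {} v) \<le> \<rho> (card {1..n})" if "v \<in> {1..n}" for v
    proof -
      have "free {} {} v \<subseteq> {v} \<times> ({1..n} - {v})"
        by (auto simp: free_def E_def complete_digraph_edges_def)
      then have "card (free {} {} v) \<le> card ({v} \<times> ({1..n} - {v}))"
        by (intro card_mono) auto
      also have "\<dots> = n - 1"
        using that by (simp add: card_cartesian_product)
      finally show ?thesis
        using box by (simp add: \<rho>_def)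
    qed
    then show "I {} {}"
      unfolding I_def using n by (intro exI[of _ "{1..n}"]) auto
  next
    fix M B e
    assume inv: "I M B" and e: "e \<in> E - (M \<union> B)"
    then obtain L where L: "L \<noteq> {}" "L \<subseteq> {1..n}" "\<And>v w. v \<in> L \<Longrightarrow> (v, w) \<notin> M"
      "\<And>v. v \<in> L \<Longrightarrow> card (free M B v) \<le> \<rho> (card L)"
      unfolding I_def by blast
    define U where "U = E - (M \<union> B) - {e}"
    have finL: "finite L" and finU: "finite U"
      using L(2) finE by (auto simp: U_def intro: finite_subset)
    \<comment> \<open>Breaker plans only \<open>Y\<close>, of size at most \<open>b\<close>. He
      fills it up to a legal move with arbitrary edges, which can only shrink the free parts of the
      stars.\<close>
    have extend: "\<exists>X \<subseteq> U. card X = min b (card U) \<and> I (insert e M) (B \<union> X)"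
      if L': "L' \<noteq> {}" "L' \<subseteq> L - {fst e}"
        and Y: "Y \<subseteq> U" "card Y \<le> b" "\<And>v. v \<in> L' \<Longrightarrow> card (free (insert e M) (B \<union> Y) v) \<le> \<rho> (card L')"
      for L' Y
    proof -
      have "card Y \<le> min b (card U)"
        using Y(1,2) card_mono[OF finU] by simp
      then obtain X where X: "Y \<subseteq> X" "X \<subseteq> U" "card X = min b (card U)"
        using exists_subset_between[of Y "min b (card U)" U] Y(1) finU by auto
      have "card (free (insert e M) (B \<union> X) v) \<le> \<rho> (card L')" if "v \<in> L'" for v
        by (rule order_trans[OF free_mono Y(3)[OF that]]) (use X(1) in auto)
      then have "I (insert e M) (B \<union> X)"
        unfolding I_def using L' L(2,3) by (intro exI[of _ L']) (auto simp: subset_iff)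
      then show ?thesis
        using X(2,3) by blast
    qed
    have "\<exists>X \<subseteq> U. card X = min b (card U) \<and> I (insert e M) (B \<union> X)"
    proof (cases "card L = 1")
      \<comment> \<open>The game is decided: the one remaining out-star has no unclaimed edge, so
        Maker's edge lies elsewhere and \<open>L\<close> is kept.\<close>
      case True
      have "card (free M B v) = 0" if "v \<in> L" for v
        using L(4)[OF that] True by (simp add: \<rho>_def)
      then have empty: "free M B v = {}" if "v \<in> L" for v
        using that fin_free by simp
      then have "fst e \<notin> L"
        using e by (cases e) (auto simp: free_def)
      moreover have "card (free (insert e M) (B \<union> {}) v) \<le> \<rho> (card L)" if "v \<in> L" for v
        by (rule order_trans[OF free_mono L(4)[OF that]]) auto
      ultimately show ?thesis
        by (intro extend[of L "{}"]) (use L(1) in auto)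
    next
      case False
      have "card L \<noteq> 0"
        using L(1) finL by simp
      with False obtain s where s: "card L = Suc s" "s \<ge> 1"
        by (cases "card L") auto
      \<comment> \<open>The size drops by exactly one even if Maker's edge misses \<open>L\<close>,
        so that \<open>b\<close> always splits over \<open>s\<close> stars.\<close>
      obtain L' where L': "L' \<subseteq> L - {fst e}" "card L' = s"
      proof -
        have "s \<le> card (L - {fst e})"
          using s(1) finL by (simp add: card_Diff_singleton_if)
        then show thesis
          using that obtain_subset_with_card_n by metis
      qed
      have finL': "finite L'"
        using L'(1) finL by (auto intro: finite_subset)
      have \<rho>s: "\<rho> (card L) = \<rho> s + b div s"
        using s by (simp add: \<rho>_def)
      have "\<exists>Z. Z \<subseteq> free M B v \<and> card Z = min (b div s) (card (free M B v))" for v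
        using obtain_subset_with_card_n[of "min (b div s) (card (free M B v))" "free M B v"] by auto
      then obtain Z where Z: "\<And>v. Z v \<subseteq> free M B v"
          "\<And>v. card (Z v) = min (b div s) (card (free M B v))"
        by metis
      define Y where "Y = (\<Union>v\<in>L'. Z v)"
      have "card Y \<le> card L' * (b div s)"
        unfolding Y_def using Z(2) finL' by (intro card_UN_le_mult) auto
      also have "\<dots> \<le> b"
        using L'(2) by simp
      finally have "card Y \<le> b" .
      moreover have "Y \<subseteq> U"
        using Z(1) L'(1) by (fastforce simp: Y_def U_def free_def)
      moreover have "card (free (insert e M) (B \<union> Y) v) \<le> \<rho> (card L')" if v: "v \<in> L'" for v
      proof -
        have "free (insert e M) (B \<union> Y) v \<subseteq> free M B v - Z v"
          using v by (auto simp: free_def Y_def)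
        then have "card (free (insert e M) (B \<union> Y) v) \<le> card (free M B v - Z v)"
          using fin_free by (intro card_mono) auto
        also have "\<dots> = card (free M B v) - card (Z v)"
          by (intro card_Diff_subset Z(1) finite_subset[OF Z(1) fin_free])
        also have "\<dots> \<le> \<rho> s"
          using L(4)[of v] v L'(1) Z(2)[of v] \<rho>s by auto
        finally show ?thesis
          using L'(2) by simp
      qed
      moreover have "L' \<noteq> {}"
        using L'(2) s(2) by auto
      ultimately show ?thesis
        using L'(1) by (intro extend[of L' Y]) auto
    qed
    then show "\<exists>X \<subseteq> E - (M \<union> B) - {e}. card X = min b (card (E - (M \<union> B) - {e})) \<and>
        I (insert e M) (B \<union> X)"
      by (simp add: U_def)
  next
    fix M B
    assume "I M B"
    then show "\<not> strongly_connected (digraph_on n M)"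
      using not_strongly_connected_if_sink[OF n] unfolding I_def by blast
  qed
  then show ?thesis
    by (simp add: breaker_wins_strong_connectivity_def E_def)
qed

text \<open>Rounding down loses at most 1 in each of the terms with \<open>i \<le> b\<close>, hence
  \<open>b\<close> in total; what remains is \<open>b\<close> times a harmonic number.\<close>

lemma sum_div_ge:
  fixes b n :: nat
  assumes "b \<ge> 1" "b < n"
  shows "real (\<Sum>i=1..<n. b div i) \<ge> real b * ln (real b) - real b"
proof -
  have "real b * ln (real b) - real b \<le> real b * harm b - real b"
    using assms(1) by (intro diff_right_mono mult_left_mono order_trans[OF _ ln_le_harm]) auto
  also have "\<dots> = (\<Sum>i=1..b. real b / real i - 1)"
    by (simp add: harm_def sum_subtractf sum_distrib_left divide_inverse)
  also have "\<dots> \<le> (\<Sum>i=1..b. real (b div i))"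
  proof (rule sum_mono)
    fix i :: nat
    assume "i \<in> {1..b}"
    show "real b / real i - 1 \<le> real (b div i)"
      using floor_divide_of_nat_eq[of b i, where 'a = real] by linarith
  qed
  also have "\<dots> \<le> (\<Sum>i=1..<n. real (b div i))"
    by (rule sum_mono2) (use assms in auto)
  finally show ?thesis by simp
qed

text \<open>At the threshold \<open>x n\<close> the bound \<open>x ln x - x\<close> is asymptotic to
  \<open>(1 + \<epsilon>) * n\<close>, which exceeds \<open>n\<close>.\<close>

lemma breaker_wins_eventually:
  fixes \<epsilon> :: real
  assumes "\<epsilon> > 0"
  shows "\<forall>\<^sub>F n :: nat in sequentially. \<forall>b :: nat. b \<ge> 1 \<longrightarrow>
    real b \<ge> (1 + \<epsilon>) * real n / ln (real n) \<longrightarrow> breaker_wins_strong_connectivity n b"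
proof -
  define x where "x = (\<lambda>n. (1 + \<epsilon>) * real n / ln (real n))"
  have "\<forall>\<^sub>F n :: nat in sequentially. x n * ln (x n) - x n \<ge> real n"
    unfolding x_def using assms by real_asymp
  moreover have "\<forall>\<^sub>F n :: nat in sequentially. x n \<ge> 1"
    unfolding x_def using assms by real_asymp
  ultimately show ?thesis
    using eventually_ge_at_top[of 2]
  proof eventually_elim
    case (elim n)
    show ?case
    proof (intro allI impI)
      fix b :: nat
      assume b: "b \<ge> 1" "(1 + \<epsilon>) * real n / ln (real n) \<le> real b"
      have "n - 1 \<le> (\<Sum>i=1..<n. b div i)"
      proof (cases "b < n")
        case True
        have xb: "x n \<le> real b"
          using b(2) by (simp add: x_def)
        have "real n \<le> x n * (ln (x n) - 1)"
          using elim(1) by (simp add: algebra_simps)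
        also have "\<dots> \<le> real b * (ln (real b) - 1)"
        proof -
          \<comment> \<open>Nonnegativity makes \<open>y * (ln y - 1)\<close> monotone from
            \<open>x n\<close> up to \<open>b\<close>. It holds because the product at
            \<open>x n\<close> is at least \<open>n > 0\<close>.\<close>
          have "0 \<le> ln (x n) - 1"
          proof (rule ccontr)
            assume "\<not> 0 \<le> ln (x n) - 1"
            then have "x n * (ln (x n) - 1) \<le> 0"
              using elim(2) by (intro mult_nonneg_nonpos) auto
            then show False
              using \<open>real n \<le> x n * (ln (x n) - 1)\<close> elim(3) by linarith
          qed
          moreover have "ln (x n) \<le> ln (real b)"
            using xb elim(2) by simp
          ultimately show ?thesis
            using xb elim(2) by (intro mult_mono) auto
        qed
        also have "\<dots> \<le> real (\<Sum>i=1..<n. b div i)"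
          using sum_div_ge[OF b(1) True] by (simp add: algebra_simps)
        finally show ?thesis by linarith
      next
        case False
        have "b div 1 \<le> (\<Sum>i=1..<n. b div i)"
          by (rule member_le_sum) (use elim in auto)
        with False show ?thesis by simp
      qed
      then show "breaker_wins_strong_connectivity n b"
        by (rule breaker_wins_box[OF elim(3) b(1)])
    qed
  qed
qed

section \<open>The stars of the complete digraph as boxes\<close>

text \<open>The boolean is a direction: the box \<open>(c, v)\<close> is the in-star of
  \<open>v\<close> for \<open>True\<close> and the out-star for \<open>False\<close>, and
  \<open>u\<close> is the other end of the edge. A proof for a generic \<open>c\<close> thus covers
  paths from the root and paths to the root at once.\<close>

definition edge :: "bool \<Rightarrow> nat \<Rightarrow> nat \<Rightarrow> nat \<times> nat" where
  "edge c u v = (if c then (u, v) else (v, u))"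

text \<open>The other end ranges over all numbers, loops included; stars are only met through their
  intersection with a set of claimed edges.\<close>

definition star :: "bool \<times> nat \<Rightarrow> (nat \<times> nat) set" where
  "star \<beta> = range (\<lambda>u. edge (fst \<beta>) u (snd \<beta>))"

definition orient :: "bool \<Rightarrow> (nat \<times> nat) set \<Rightarrow> (nat \<times> nat) set" where
  "orient c M = {(u, v). edge c u v \<in> M}"

definition danger :: "(nat \<times> nat) set \<Rightarrow> bool \<times> nat \<Rightarrow> nat" where
  "danger B \<beta> = card (B \<inter> star \<beta>)"

definition covered :: "(nat \<times> nat) set \<Rightarrow> (bool \<times> nat) set \<Rightarrow> nat" where
  "covered B J = card (B \<inter> \<Union>(star ` J))"

lemma edge_eq_iff [simp]: "edge c u v = edge c u' v' \<longleftrightarrow> u = u' \<and> v = v'"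
  by (auto simp: edge_def)

lemma edge_in_E_iff [simp]:
  "edge c u v \<in> complete_digraph_edges n \<longleftrightarrow> u \<in> {1..n} \<and> v \<in> {1..n} \<and> u \<noteq> v"
  by (auto simp: edge_def complete_digraph_edges_def)

lemma edge_in_star [simp]: "edge c u v \<in> star (c, v)"
  by (auto simp: star_def)

lemma in_orient_iff [simp]: "(u, v) \<in> orient c M \<longleftrightarrow> edge c u v \<in> M"
  by (simp add: orient_def)

lemma orient_mono: "M \<subseteq> M' \<Longrightarrow> (orient c M)\<^sup>* \<subseteq> (orient c M')\<^sup>*"
  by (rule rtrancl_mono) (auto simp: orient_def)

lemma in_star_iff: "e \<in> star \<beta> \<longleftrightarrow> \<beta> = (True, snd e) \<or> \<beta> = (False, fst e)"
  by (cases \<beta>; cases e) (auto simp: star_def edge_def)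

lemma card_complete_digraph_edges: "card (complete_digraph_edges n) = n * (n - 1)"
proof -
  have "complete_digraph_edges n = Sigma {1..n} (\<lambda>i. {1..n} - {i})"
    by (auto simp: complete_digraph_edges_def)
  then show ?thesis by simp
qed

lemma danger_mono: "finite B' \<Longrightarrow> B \<subseteq> B' \<Longrightarrow> danger B \<beta> \<le> danger B' \<beta>"
  unfolding danger_def by (intro card_mono) auto

lemma covered_singleton [simp]: "covered B {\<beta>} = danger B \<beta>"
  by (simp add: covered_def danger_def)

lemma covered_le_sum_danger:
  assumes "finite J"
  shows "covered B J \<le> (\<Sum>\<beta>\<in>J. danger B \<beta>)"
proof -
  have "B \<inter> \<Union>(star ` J) = (\<Union>\<beta>\<in>J. B \<inter> star \<beta>)"
    by auto
  then show ?thesis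
    unfolding covered_def danger_def using card_UN_le[OF assms] by metis
qed

text \<open>Double counting: an edge lies in just two stars, the in-star of its head and the
  out-star of its tail.\<close>

lemma sum_danger_le:
  assumes "finite B" "finite J"
  shows "(\<Sum>\<beta>\<in>J. danger B \<beta>) \<le> 2 * card B"
proof -
  have "(\<Sum>\<beta>\<in>J. danger B \<beta>) = (\<Sum>\<beta>\<in>J. \<Sum>e\<in>B. if e \<in> star \<beta> then 1 else 0)"
    unfolding danger_def by (intro sum.cong refl) (use assms in \<open>simp add: sum.If_cases\<close>)
  also have "\<dots> = (\<Sum>e\<in>B. \<Sum>\<beta>\<in>J. if e \<in> star \<beta> then 1 else 0)"
    by (rule sum.swap)
  also have "\<dots> \<le> (\<Sum>e\<in>B. 2)"
  proof (rule sum_mono)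
    fix e
    have "(\<Sum>\<beta>\<in>J. if e \<in> star \<beta> then 1 else 0) = card (J \<inter> {\<beta>. e \<in> star \<beta>})"
      using assms(2) by (simp add: sum.If_cases)
    also have "\<dots> \<le> card {(True, snd e), (False, fst e)}"
      by (intro card_mono) (auto simp: in_star_iff)
    finally show "(\<Sum>\<beta>\<in>J. if e \<in> star \<beta> then 1 else 0) \<le> (2 :: nat)"
      by simp
  qed
  finally show ?thesis by simp
qed

lemma danger_Un_le: "danger (B \<union> X) \<beta> \<le> danger B \<beta> + danger X \<beta>"
  unfolding danger_def by (metis Int_Un_distrib2 card_Un_le)

lemma sum_danger_Un_le:
  assumes "finite X" "finite J"
  shows "(\<Sum>\<beta>\<in>J. danger (B \<union> X) \<beta>) \<le> (\<Sum>\<beta>\<in>J. danger B \<beta>) + 2 * card X"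
proof -
  have "(\<Sum>\<beta>\<in>J. danger (B \<union> X) \<beta>) \<le> (\<Sum>\<beta>\<in>J. danger B \<beta> + danger X \<beta>)"
    by (intro sum_mono danger_Un_le)
  then show ?thesis
    using sum_danger_le[OF assms] by (simp add: sum.distrib)
qed

lemma covered_Un_le:
  assumes "finite X"
  shows "covered (B \<union> X) J \<le> covered B J + card X"
proof -
  have "covered (B \<union> X) J \<le> covered B J + card (X \<inter> \<Union>(star ` J))"
    unfolding covered_def by (metis Int_Un_distrib2 card_Un_le)
  moreover have "card (X \<inter> \<Union>(star ` J)) \<le> card X"
    using assms by (intro card_mono) auto
  ultimately show ?thesis by linarith
qed

text \<open>Two distinct stars share at most one edge.\<close>

lemma danger_le_covered_diff:
  assumes "finite B" "finite J" "x \<notin> J"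
  shows "danger B x + covered B J \<le> covered B (insert x J) + card J"
proof -
  have "card (B \<inter> star x \<inter> star y) \<le> 1" if "y \<in> J" for y
  proof -
    have "x \<noteq> y"
      using that assms(3) by blast
    then have "e = e'" if "e \<in> star x \<inter> star y" "e' \<in> star x \<inter> star y" for e e'
      using that by (cases e; cases e') (auto simp: in_star_iff)
    then have "is_singleton (B \<inter> star x \<inter> star y) \<or> B \<inter> star x \<inter> star y = {}"
      unfolding is_singleton_def by blast
    then show ?thesis
      by (auto simp: is_singleton_altdef)
  qed
  then have "card (\<Union>y\<in>J. B \<inter> star x \<inter> star y) \<le> card J"
    using card_UN_le_mult[of J "\<lambda>y. B \<inter> star x \<inter> star y" 1] assms(2) by simp
  moreover have "(\<Union>y\<in>J. B \<inter> star x \<inter> star y) = (B \<inter> star x) \<inter> (B \<inter> \<Union>(star ` J))"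
    by auto
  moreover have "(B \<inter> star x) \<union> (B \<inter> \<Union>(star ` J)) = B \<inter> \<Union>(star ` insert x J)"
    by auto
  ultimately show ?thesis
    using card_Un_Int[of "B \<inter> star x" "B \<inter> \<Union>(star ` J)"] assms(1)
    by (simp add: danger_def covered_def)
qed

section \<open>The potential of a set of boxes\<close>

text \<open>The sum of the dangers counts an edge twice when both its stars are in the set, and so may
  grow by \<open>2 b\<close> in a turn; the number of covered edges grows by at most \<open>b\<close>. For small sets this
  outweighs the loss of 1 on average that the common edges of the stars cause when a box is removed.\<close>

definition potential :: "nat \<Rightarrow> (nat \<times> nat) set \<Rightarrow> (bool \<times> nat) set \<Rightarrow> nat" where
  "potential j\<^sub>0 B J = (if card J < j\<^sub>0 then covered B J else (\<Sum>\<beta>\<in>J. danger B \<beta>))"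

text \<open>The rise per turn that the average over \<open>i\<close> boxes is allowed:
  \<open>i\<close> times it is \<open>i\<close> shared edges plus \<open>b\<close> new ones when
  covered edges are counted, and \<open>2 * b\<close> when dangers are summed.\<close>

definition weight :: "nat \<Rightarrow> nat \<Rightarrow> nat \<Rightarrow> real" where
  "weight j\<^sub>0 b i = (if i < j\<^sub>0 then 1 + real b / real i else 2 * real b / real i)"

text \<open>Bound for the average potential of a set of \<open>j\<close> untreated boxes: it starts
  from \<open>a\<close> and collects one weight for each size from \<open>N\<close> down to
  \<open>j\<close>. At \<open>j = 1\<close> it bounds the danger of a single box.\<close>

definition level :: "nat \<Rightarrow> nat \<Rightarrow> nat \<Rightarrow> real \<Rightarrow> nat \<Rightarrow> real" where
  "level j\<^sub>0 b N a j = a + (\<Sum>i=j..N. weight j\<^sub>0 b i)"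

lemma weight_nonneg [simp]: "weight j\<^sub>0 b i \<ge> 0"
  by (simp add: weight_def)

lemma level_Suc: "j \<le> N \<Longrightarrow> level j\<^sub>0 b N a j = weight j\<^sub>0 b j + level j\<^sub>0 b N a (Suc j)"
  by (simp add: level_def sum.atLeast_Suc_atMost)

lemma level_ge: "a \<le> level j\<^sub>0 b N a j"
  by (simp add: level_def sum_nonneg)

text \<open>A box of maximal danger has at least the average danger, so dropping it does not raise
  the average; Breaker's reply then adds at most \<open>2 * b\<close> to the sum. If covered edges
  are counted, up to \<open>card J\<close> edges of \<open>x\<close> stay covered by the other
  boxes, which is the summand 1 in \<open>weight\<close>, but the reply adds only
  \<open>b\<close>.\<close>

lemma potential_treat:
  assumes fin: "finite B" "finite X" "finite J" and X: "card X \<le> b"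
    and J: "J \<noteq> {}" "card J < N" "x \<notin> J" and max: "\<And>y. y \<in> J \<Longrightarrow> danger B y \<le> danger B x"
    and pot: "real (potential j\<^sub>0 B (insert x J)) \<le> real (Suc (card J)) * level j\<^sub>0 b N a (Suc (card J))"
  shows "real (potential j\<^sub>0 (B \<union> X) J) \<le> real (card J) * level j\<^sub>0 b N a (card J)"
proof -
  define j where "j = card J"
  define S where "S = (\<Sum>\<beta>\<in>J. danger B \<beta>)"
  define d where "d = danger B x"
  define L where "L = level j\<^sub>0 b N a (Suc j)"
  have j: "j \<ge> 1" "real j > 0"
    using J(1) fin(3) by (auto simp: j_def card_gt_0_iff Suc_le_eq)
  have S: "S \<le> j * d"
    unfolding S_def j_def d_def using sum_bounded_above[of J "danger B" d] max by (simp add: d_def)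
  have cS: "covered B J \<le> S"
    unfolding S_def by (rule covered_le_sum_danger[OF fin(3)])
  have card': "card (insert x J) = Suc j"
    using fin(3) J(3) by (simp add: j_def)
  have sum': "(\<Sum>\<beta>\<in>insert x J. danger B \<beta>) = d + S"
    using fin(3) J(3) by (simp add: S_def d_def)
  have lev: "real j * level j\<^sub>0 b N a j = real j * weight j\<^sub>0 b j + real j * L"
    unfolding L_def using J(2) by (simp add: level_Suc j_def distrib_left)
  have pot': "real (potential j\<^sub>0 B (insert x J)) \<le> (real j + 1) * L"
    using pot by (simp add: L_def j_def add.commute)
  have sum_case: "real S \<le> real j * L" if "\<not> Suc j < j\<^sub>0"
  proof -
    have "real S + real d \<le> (real j + 1) * L"
      using pot' that card' sum' by (simp add: potential_def)
    then have "real j * (real S + real d) \<le> real j * ((real j + 1) * L)"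
      using j(2) by (intro mult_left_mono) auto
    moreover have "real S \<le> real j * real d"
      using S by (metis of_nat_mono of_nat_mult)
    ultimately have "(real j + 1) * real S \<le> (real j + 1) * (real j * L)"
      by (simp add: algebra_simps)
    then show ?thesis
      by (rule mult_left_le_imp_le) (use j in auto)
  qed
  show ?thesis
  proof (cases "j < j\<^sub>0")
    case True
    have "real (covered B J) \<le> real j * L + real j"
    proof (cases "Suc j < j\<^sub>0")
      case True
      define U where "U = covered B J"
      define U' where "U' = covered B (insert x J)"
      have U': "real U' \<le> (real j + 1) * L"
        using pot' True card' by (simp add: potential_def U'_def)
      have "d + U \<le> U' + j"
        using danger_le_covered_diff[OF fin(1,3) J(3)] by (simp add: d_def U_def U'_def j_def)
      then have "real d + real U \<le> real U' + real j"
        by (simp flip: of_nat_add)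
      then have "real j * (real d + real U) \<le> real j * ((real j + 1) * L + real j)"
        using j(2) U' by (intro mult_left_mono) auto
      moreover have "real U \<le> real j * real d"
        using S cS unfolding U_def by (metis of_nat_mono of_nat_mult order_trans)
      ultimately have "(real j + 1) * real U \<le> (real j + 1) * (real j * L) + real j * real j"
        by (simp add: algebra_simps)
      also have "\<dots> \<le> (real j + 1) * (real j * L + real j)"
        by (simp add: algebra_simps)
      finally have "real U \<le> real j * L + real j"
        by (rule mult_left_le_imp_le) (use j in auto)
      then show ?thesis by (simp add: U_def)
    next
      \<comment> \<open>The size passes \<open>j\<^sub>0\<close> here: the larger set is measured by
        the sum of dangers, and the covered edges of \<open>J\<close> are at most the sum over
        \<open>J\<close>.\<close>
      case False
      from sum_case[OF this] cS show ?thesis by linarith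
    qed
    moreover have "covered (B \<union> X) J \<le> covered B J + b"
      using covered_Un_le[OF fin(2), of B J] X by linarith
    then have "real (covered (B \<union> X) J) \<le> real (covered B J) + real b"
      by (simp flip: of_nat_add)
    moreover have "real j * weight j\<^sub>0 b j = real j + real b"
      using True j by (simp add: weight_def field_simps)
    ultimately have "real (covered (B \<union> X) J) \<le> real j * level j\<^sub>0 b N a j"
      using lev by linarith
    with True show ?thesis by (simp add: potential_def j_def)
  next
    case False
    have "(\<Sum>\<beta>\<in>J. danger (B \<union> X) \<beta>) \<le> S + 2 * b"
      using sum_danger_Un_le[OF fin(2,3), of B] X unfolding S_def by linarith
    then have "real (\<Sum>\<beta>\<in>J. danger (B \<union> X) \<beta>) \<le> real S + 2 * real b"
      by linarith
    moreover have "real j * weight j\<^sub>0 b j = 2 * real b"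
      using False j by (simp add: weight_def)
    ultimately have "real (\<Sum>\<beta>\<in>J. danger (B \<union> X) \<beta>) \<le> real j * level j\<^sub>0 b N a j"
      using lev sum_case False by linarith
    with False show ?thesis by (simp add: potential_def j_def)
  qed
qed

text \<open>If all dangers are at most \<open>a\<close>, the average is at most \<open>a\<close>
  whatever happened before, and one weight on top of \<open>a\<close> absorbs Breaker's reply. So
  Maker may spend such a turn without treating a box.\<close>

lemma potential_calm:
  assumes fin: "finite X" "finite J" and X: "card X \<le> b"
    and J: "J \<noteq> {}" "card J \<le> N" and calm: "\<And>y. y \<in> J \<Longrightarrow> real (danger B y) \<le> a"
  shows "real (potential j\<^sub>0 (B \<union> X) J) \<le> real (card J) * level j\<^sub>0 b N a (card J)"
proof -
  define j where "j = card J"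
  define S where "S = (\<Sum>\<beta>\<in>J. danger B \<beta>)"
  have j: "j \<ge> 1" "real j > 0"
    using J(1) fin(2) by (auto simp: j_def card_gt_0_iff Suc_le_eq)
  have S: "real S \<le> real j * a"
    using sum_bounded_above[of J "\<lambda>y. real (danger B y)" a] calm by (simp add: S_def j_def)
  have "real j * level j\<^sub>0 b N a j = real j * weight j\<^sub>0 b j + real j * level j\<^sub>0 b N a (Suc j)"
    using J(2) by (simp add: level_Suc j_def distrib_left)
  moreover have "real j * a \<le> real j * level j\<^sub>0 b N a (Suc j)"
    by (intro mult_left_mono level_ge) simp
  ultimately have lev: "real j * weight j\<^sub>0 b j + real S \<le> real j * level j\<^sub>0 b N a j"
    using S by linarith
  show ?thesis
  proof (cases "j < j\<^sub>0")
    case True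
    have "covered (B \<union> X) J \<le> S + b"
      using covered_Un_le[OF fin(1), of B J] covered_le_sum_danger[OF fin(2), of B] X
      unfolding S_def by linarith
    then have "real (covered (B \<union> X) J) \<le> real S + real b"
      by (simp flip: of_nat_add)
    moreover have "real j * weight j\<^sub>0 b j \<ge> real b"
      using True j by (simp add: weight_def field_simps)
    ultimately show ?thesis
      using lev True by (simp add: potential_def j_def)
  next
    case False
    have "(\<Sum>\<beta>\<in>J. danger (B \<union> X) \<beta>) \<le> S + 2 * b"
      using sum_danger_Un_le[OF fin, of B] X unfolding S_def by linarith
    then have "real (\<Sum>\<beta>\<in>J. danger (B \<union> X) \<beta>) \<le> real S + 2 * real b"
      by linarith
    moreover have "real j * weight j\<^sub>0 b j = 2 * real b"
      using False j by (simp add: weight_def)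
    ultimately have "real (\<Sum>\<beta>\<in>J. danger (B \<union> X) \<beta>) \<le> real j * level j\<^sub>0 b N a j"
      using lev by linarith
    with False show ?thesis by (simp add: potential_def j_def)
  qed
qed

section \<open>Maker's strategy\<close>

text \<open>\<open>orient False M\<close> is the converse of \<open>M\<close>, so the last
  hypothesis gives paths both from and to the root, and \<open>u\<close> reaches \<open>v\<close>
  through 1.\<close>

lemma strongly_connected_if_root:
  assumes "n \<ge> 1" "M \<subseteq> complete_digraph_edges n"
    and "\<And>c v. v \<in> {1..n} \<Longrightarrow> (1, v) \<in> (orient c M)\<^sup>*"
  shows "strongly_connected (digraph_on n M)"
proof (rule strongly_connectedI)
  show "verts (digraph_on n M) \<noteq> {}"
    using assms(1) by (simp add: digraph_on_def)
next
  fix u v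
  assume "u \<in> verts (digraph_on n M)" "v \<in> verts (digraph_on n M)"
  then have uv: "u \<in> {1..n}" "v \<in> {1..n}"
    by (simp_all add: digraph_on_def)
  have "orient True M = M" "orient False M = M\<inverse>"
    by (auto simp: orient_def edge_def)
  then have "(u, 1) \<in> M\<^sup>*" "(1, v) \<in> M\<^sup>*"
    using assms(3)[OF uv(1), of False] assms(3)[OF uv(2), of True] by (auto simp: rtrancl_converse)
  then have "(u, v) \<in> M\<^sup>*" by simp
  then have "(u, v) \<in> rtrancl_on {1..n} M"
  proof (induction rule: rtrancl_induct)
    case base
    then show ?case using uv(1) by simp
  next
    case (step y z)
    have "z \<in> {1..n}"
      using step(2) assms(2) by (auto simp: complete_digraph_edges_def)
    with step show ?case by (blast intro: rtrancl_on_into_rtrancl_on)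
  qed
  then show "u \<rightarrow>\<^sup>*\<^bsub>digraph_on n M\<^esub> v"
    by (simp add: reachable_def digraph_on_def arcs_ends_def arc_to_ends_def)
qed

text \<open>\<open>k\<close> is the final size of a core, \<open>a\<close> the danger below which
  Maker may grow cores, \<open>j\<^sub>0\<close> the switch in the potential. By
  \<open>short\<close>, \<open>2 * k + 2 * n\<close> turns do not exhaust the board. By
  \<open>room\<close>, an untreated star keeps an edge from a vertex that is not deferred. The
  bounds on \<open>b\<close> serve the growth of the cores.\<close>

locale maker_strategy =
  fixes n b k j\<^sub>0 :: nat and a :: real
  assumes n: "n \<ge> 2" and k: "k \<ge> 1" "real k \<le> a" "k \<le> n"
    and b: "b \<ge> 1" "4 * real b \<le> a" "k + 6 * b < n"
    and short: "(b + 1) * (2 * k + 2 * n) < n * (n - 1)"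
    and room: "4 * real b * real n / real k + 1 + level j\<^sub>0 b (2 * n) a 1 < real n"
begin

abbreviation "E \<equiv> complete_digraph_edges n"
abbreviation "V \<equiv> {1..n}"
abbreviation "lev \<equiv> level j\<^sub>0 b (2 * n) a"

text \<open>Maker has claimed \<open>M\<close> and Breaker \<open>B\<close>. In the digraph \<open>orient c M\<close>, the core
  \<open>C c\<close> is reachable from the root 1; \<open>A\<close> are the boxes that still have to be treated; \<open>D c\<close> are
  the vertices that Maker could not join to the core. The term \<open>2 * n - card A\<close> is
  the number of treated boxes, so that the two cardinality bounds count the turns played.\<close>

definition inv :: "(nat \<times> nat) set \<Rightarrow> (nat \<times> nat) set \<Rightarrow> (bool \<Rightarrow> nat set) \<Rightarrow> (bool \<times> nat) set \<Rightarrow>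
    (bool \<Rightarrow> nat set) \<Rightarrow> bool" where
  "inv M B C A D \<longleftrightarrow>
    M \<subseteq> E \<and> B \<subseteq> E \<and> A \<subseteq> UNIV \<times> V \<and>
    (\<forall>c. 1 \<in> C c \<and> C c \<subseteq> V \<and> card (C c) \<le> k \<and> card (C c) \<le> card (C (\<not> c)) + 1 \<and>
      (\<forall>w\<in>C c. (1, w) \<in> (orient c M)\<^sup>*)) \<and>
    (\<forall>c. D c \<subseteq> V \<and> (\<forall>v\<in>V. \<exists>u\<in>V - D c. (u, v) \<in> (orient c M)\<^sup>*) \<and>
      (\<forall>v\<in>V - D c. (c, v) \<notin> A \<longrightarrow> (1, v) \<in> (orient c M)\<^sup>*) \<and>
      (\<forall>v\<in>D c. k \<le> danger B (c, v))) \<and>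
    card M \<le> card (C True) + card (C False) + (2 * n - card A) \<and>
    card B \<le> b * (card (C True) + card (C False) + (2 * n - card A)) \<and>
    ((\<exists>c. card (C c) < k) \<longrightarrow> (\<forall>\<beta>\<in>UNIV \<times> V - A. a \<le> danger B \<beta>)) \<and>
    (\<forall>J\<subseteq>A. J \<noteq> {} \<longrightarrow> potential j\<^sub>0 B J \<le> card J * lev (card J))"

lemma finite_boxes [simp]: "finite (UNIV \<times> V :: (bool \<times> nat) set)"
  by simp

lemma card_boxes: "card (UNIV \<times> V :: (bool \<times> nat) set) = 2 * n"
  by (simp add: card_cartesian_product)

lemma
  assumes "inv M B C A D"
  shows inv_sub: "M \<subseteq> E" "B \<subseteq> E" "A \<subseteq> UNIV \<times> V"
    and inv_core: "1 \<in> C c" "C c \<subseteq> V" "card (C c) \<le> k" "card (C c) \<le> card (C (\<not> c)) + 1"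
      "w \<in> C c \<Longrightarrow> (1, w) \<in> (orient c M)\<^sup>*"
    and inv_deferred: "D c \<subseteq> V" "v \<in> V \<Longrightarrow> \<exists>u\<in>V - D c. (u, v) \<in> (orient c M)\<^sup>*"
      "v \<in> V - D c \<Longrightarrow> (c, v) \<notin> A \<Longrightarrow> (1, v) \<in> (orient c M)\<^sup>*"
      "v \<in> D c \<Longrightarrow> k \<le> danger B (c, v)"
    and inv_card: "card M \<le> card (C True) + card (C False) + (2 * n - card A)"
      "card B \<le> b * (card (C True) + card (C False) + (2 * n - card A))"
    and inv_growing: "card (C c) < k \<Longrightarrow> \<beta> \<in> UNIV \<times> V - A \<Longrightarrow> a \<le> danger B \<beta>"
    and inv_pot: "J \<subseteq> A \<Longrightarrow> J \<noteq> {} \<Longrightarrow> potential j\<^sub>0 B J \<le> card J * lev (card J)"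
proof -
  have core: "\<forall>c. 1 \<in> C c \<and> C c \<subseteq> V \<and> card (C c) \<le> k \<and> card (C c) \<le> card (C (\<not> c)) + 1 \<and>
      (\<forall>w\<in>C c. (1, w) \<in> (orient c M)\<^sup>*)"
    and deferred: "\<forall>c. D c \<subseteq> V \<and> (\<forall>v\<in>V. \<exists>u\<in>V - D c. (u, v) \<in> (orient c M)\<^sup>*) \<and>
      (\<forall>v\<in>V - D c. (c, v) \<notin> A \<longrightarrow> (1, v) \<in> (orient c M)\<^sup>*) \<and>
      (\<forall>v\<in>D c. k \<le> danger B (c, v))"
    and growing: "(\<exists>c. card (C c) < k) \<longrightarrow> (\<forall>\<beta>\<in>UNIV \<times> V - A. a \<le> danger B \<beta>)"
    and pot: "\<forall>J\<subseteq>A. J \<noteq> {} \<longrightarrow> potential j\<^sub>0 B J \<le> card J * lev (card J)"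
    and "M \<subseteq> E" "B \<subseteq> E" "A \<subseteq> UNIV \<times> V"
      "card M \<le> card (C True) + card (C False) + (2 * n - card A)"
      "card B \<le> b * (card (C True) + card (C False) + (2 * n - card A))"
    using assms unfolding inv_def by - (elim conjE, assumption)+
  then show "M \<subseteq> E" "B \<subseteq> E" "A \<subseteq> UNIV \<times> V"
      "card M \<le> card (C True) + card (C False) + (2 * n - card A)"
      "card B \<le> b * (card (C True) + card (C False) + (2 * n - card A))"
    by - assumption+
  show "1 \<in> C c" "C c \<subseteq> V" "card (C c) \<le> k" "card (C c) \<le> card (C (\<not> c)) + 1"
      "w \<in> C c \<Longrightarrow> (1, w) \<in> (orient c M)\<^sup>*"
    using core[rule_format, of c] by blast+
  show "D c \<subseteq> V" "v \<in> V \<Longrightarrow> \<exists>u\<in>V - D c. (u, v) \<in> (orient c M)\<^sup>*"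
      "v \<in> V - D c \<Longrightarrow> (c, v) \<notin> A \<Longrightarrow> (1, v) \<in> (orient c M)\<^sup>*"
      "v \<in> D c \<Longrightarrow> k \<le> danger B (c, v)"
    using deferred[rule_format, of c] by blast+
  show "card (C c) < k \<Longrightarrow> \<beta> \<in> UNIV \<times> V - A \<Longrightarrow> a \<le> danger B \<beta>"
    using growing by blast
  show "J \<subseteq> A \<Longrightarrow> J \<noteq> {} \<Longrightarrow> potential j\<^sub>0 B J \<le> card J * lev (card J)"
    using pot by blast
qed

lemma invI:
  assumes "M \<subseteq> E" "B \<subseteq> E" "A \<subseteq> UNIV \<times> V"
    and "\<And>c. 1 \<in> C c" "\<And>c. C c \<subseteq> V" "\<And>c. card (C c) \<le> k"
      "\<And>c. card (C c) \<le> card (C (\<not> c)) + 1"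
      "\<And>c w. w \<in> C c \<Longrightarrow> (1, w) \<in> (orient c M)\<^sup>*"
    and "\<And>c. D c \<subseteq> V" "\<And>c v. v \<in> V \<Longrightarrow> \<exists>u\<in>V - D c. (u, v) \<in> (orient c M)\<^sup>*"
      "\<And>c v. v \<in> V - D c \<Longrightarrow> (c, v) \<notin> A \<Longrightarrow> (1, v) \<in> (orient c M)\<^sup>*"
      "\<And>c v. v \<in> D c \<Longrightarrow> k \<le> danger B (c, v)"
    and "card M \<le> card (C True) + card (C False) + (2 * n - card A)"
      "card B \<le> b * (card (C True) + card (C False) + (2 * n - card A))"
    and "\<And>c \<beta>. card (C c) < k \<Longrightarrow> \<beta> \<in> UNIV \<times> V - A \<Longrightarrow> a \<le> danger B \<beta>"
    and "\<And>J. J \<subseteq> A \<Longrightarrow> J \<noteq> {} \<Longrightarrow> potential j\<^sub>0 B J \<le> card J * lev (card J)"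
  shows "inv M B C A D"
  unfolding inv_def by (intro conjI allI ballI impI; (elim exE)?; rule assms; assumption)

section \<open>Counting turns and claimed edges\<close>

lemma inv_finite:
  assumes "inv M B C A D"
  shows "finite M" "finite B" "finite A" "finite (C c)" "finite (D c)"
  by (rule finite_subset[OF inv_sub(1)[OF assms]] finite_subset[OF inv_sub(2)[OF assms]]
      finite_subset[OF inv_sub(3)[OF assms]] finite_subset[OF inv_core(2)[OF assms]]
      finite_subset[OF inv_deferred(1)[OF assms]]; simp)+

lemma inv_turns:
  assumes "inv M B C A D"
  shows "card (C True) + card (C False) + (2 * n - card A) \<le> 2 * k + 2 * n"
  using inv_core(3)[OF assms, of True] inv_core(3)[OF assms, of False] by linarith

lemma inv_B_le:
  assumes "inv M B C A D"
  shows "card B \<le> b * (2 * k + 2 * n)"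
  using inv_card(2)[OF assms] inv_turns[OF assms] by (meson mult_le_mono2 order_trans)

text \<open>At most \<open>2 * k + 2 * n\<close> turns with at most \<open>b + 1\<close> edges each
  do not fill the board, by \<open>short\<close>. So the game cannot end while \<open>inv\<close>
  holds.\<close>

lemma inv_not_full:
  assumes "inv M B C A D"
  shows "card M + card B < card E" "\<exists>e. e \<in> E - B"
proof -
  have "card M + card B \<le> (b + 1) * (2 * k + 2 * n)"
    using inv_card(1)[OF assms] inv_turns[OF assms] inv_B_le[OF assms] by simp
  then show *: "card M + card B < card E"
    using short by (simp add: card_complete_digraph_edges)
  show "\<exists>e. e \<in> E - B"
    using * inv_finite[OF assms] by (metis card_mono DiffI leD subsetI trans_le_add2)
qed

lemma inv_init: "inv {} {} (\<lambda>_. {1}) (UNIV \<times> V) (\<lambda>_. {})"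
proof -
  have "potential j\<^sub>0 {} J = 0" for J
    by (simp add: potential_def covered_def danger_def)
  moreover have "lev j \<ge> 0" for j
    using level_ge[of a j\<^sub>0 b "2 * n" j] k(2) by linarith
  ultimately show ?thesis
    using n k(1) by (intro invI) (auto simp: card_boxes)
qed

section \<open>Existence of the edges that Maker needs\<close>

lemma card_edges_to [simp]: "card ((\<lambda>u. edge c u v) ` U) = card U"
  by (rule card_image) (auto simp: inj_on_def)

lemma danger_ge_card:
  assumes "finite B" "\<And>u. u \<in> U \<Longrightarrow> edge c u v \<in> B"
  shows "card U \<le> danger B (c, v)"
proof -
  have "card ((\<lambda>u. edge c u v) ` U) \<le> danger B (c, v)"
    unfolding danger_def using assms by (intro card_mono) auto
  then show ?thesis by simp
qed

text \<open>While the cores grow, a box is treated only if Breaker has spent \<open>a\<close> edges on it. This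
  keeps Breaker's edges few compared to the core.\<close>

lemma growing_core_edge:
  assumes inv: "inv M B C A D" and c: "card (C c) < k" "card (C c) \<le> card (C (\<not> c))"
  obtains u w where "u \<in> C c" "w \<in> V - C c" "edge c u w \<in> E - B"
proof -
  define i where "i = card (C c)"
  define x where "x = 2 * n - card A"
  note fin = inv_finite[OF inv]
  have i: "i \<ge> 1"
    using inv_core(1)[OF inv, of c] fin(4)[of c] by (auto simp: i_def card_gt_0_iff Suc_le_eq)
  \<comment> \<open>The cores differ by at most one in size, so the smaller one bounds the number of
    turns spent on growth.\<close>
  have cores: "card (C True) + card (C False) \<le> 2 * i + 1"
    using inv_core(4)[OF inv, of "\<not> c"] by (cases c) (auto simp: i_def)
  have x: "card (UNIV \<times> V - A) = x"
    using card_Diff_subset[OF fin(3) inv_sub(3)[OF inv]] by (simp add: x_def card_boxes)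
  \<comment> \<open>Each of the \<open>x\<close> treated boxes has danger at least \<open>a\<close>,
    so \<open>x * a\<close> is at most twice the number of Breaker's edges, itself at most
    \<open>b * (2 * i + 1 + x)\<close>. With \<open>a \<ge> 4 * b\<close> this gives
    \<open>x \<le> 2 * i + 1\<close>, and Breaker owns at most \<open>6 * b * i\<close>
    edges.\<close>
  have "real x * a = (\<Sum>\<beta>\<in>UNIV \<times> V - A. a)"
    by (simp only: sum_constant x)
  also have "\<dots> \<le> (\<Sum>\<beta>\<in>UNIV \<times> V - A. real (danger B \<beta>))"
    by (rule sum_mono) (rule inv_growing[OF inv c(1)])
  also have "\<dots> = real (\<Sum>\<beta>\<in>UNIV \<times> V - A. danger B \<beta>)"
    by (rule of_nat_sum[symmetric])
  also have "\<dots> \<le> 2 * real (card B)"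
  proof -
    have "(\<Sum>\<beta>\<in>UNIV \<times> V - A. danger B \<beta>) \<le> 2 * card B"
      by (rule sum_danger_le[OF fin(2) finite_Diff[OF finite_boxes]])
    then have "real (\<Sum>\<beta>\<in>UNIV \<times> V - A. danger B \<beta>) \<le> real (2 * card B)"
      by (simp only: of_nat_le_iff)
    then show ?thesis
      by (simp only: of_nat_mult of_nat_numeral)
  qed
  finally have xa: "real x * a \<le> 2 * real (card B)" .
  have "card B \<le> b * (2 * i + 1 + x)"
    by (rule order_trans[OF inv_card(2)[OF inv] mult_le_mono2]) (use cores in \<open>simp add: x_def\<close>)
  then have "real (card B) \<le> real (b * (2 * i + 1 + x))"
    by (simp only: of_nat_le_iff)
  then have B: "real (card B) \<le> real b * (2 * real i + 1 + real x)"
    by (simp add: algebra_simps)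
  have "real x * (4 * real b) \<le> real x * a"
    using b(2) by (intro mult_left_mono) auto
  with xa B have "4 * real b * real x \<le> 2 * real b * (2 * real i + 1 + real x)"
    by (simp add: algebra_simps)
  then have "(2 * real b) * real x \<le> (2 * real b) * (2 * real i + 1)"
    by (simp add: algebra_simps)
  then have "real x \<le> 2 * real i + 1"
    by (rule mult_left_le_imp_le) (use b(1) in auto)
  then have "real b * (2 * real i + 1 + real x) \<le> real b * (6 * real i)"
    using i by (intro mult_left_mono) auto
  with B have B': "real (card B) \<le> 6 * real b * real i"
    by (simp add: algebra_simps)
  have "card ((\<lambda>(u, w). edge c u w) ` (C c \<times> (V - C c))) = i * (n - i)"
    using inv_core(2)[OF inv, of c] fin(4)[of c]
    by (subst card_image) (auto simp: inj_on_def card_cartesian_product card_Diff_subset i_def)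
  \<comment> \<open>There are \<open>i * (n - i)\<close> edges between the core and the other
    vertices, and \<open>n - i > 6 * b\<close> since \<open>i < k\<close>.\<close>
  moreover have "card B < i * (n - i)"
  proof -
    have "i * (6 * b) < i * (n - i)"
      using i b(3) c(1) by (simp add: i_def)
    then have "real (i * (6 * b)) < real (i * (n - i))"
      by (simp only: of_nat_less_iff)
    moreover have "real (i * (6 * b)) = 6 * real b * real i"
      by simp
    ultimately have "real (card B) < real (i * (n - i))"
      using B' by linarith
    then show ?thesis by (simp only: of_nat_less_iff)
  qed
  ultimately have "\<not> (\<lambda>(u, w). edge c u w) ` (C c \<times> (V - C c)) \<subseteq> B"
    using card_mono[OF fin(2), of "(\<lambda>(u, w). edge c u w) ` (C c \<times> (V - C c))"] by linarith
  then obtain u w where uw: "u \<in> C c" "w \<in> V - C c" "edge c u w \<notin> B"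
    by (auto simp: image_subset_iff)
  have "u \<noteq> w" "u \<in> V" "w \<in> V"
    using uw(1,2) inv_core(2)[OF inv, of c] by blast+
  with uw that show thesis
    by simp
qed

text \<open>Each deferred vertex costs Breaker \<open>k\<close> edges in its star, and stars of the
  same direction are disjoint, so no edge is counted twice.\<close>

lemma inv_card_deferred:
  assumes inv: "inv M B C A D"
  shows "real (card (D c)) \<le> 4 * real b * real n / real k"
proof -
  note fin = inv_finite[OF inv]
  have "card (D c) * k \<le> (\<Sum>v\<in>D c. card (B \<inter> star (c, v)))"
    using sum_bounded_below[of "D c" k "\<lambda>v. danger B (c, v)"] inv_deferred(4)[OF inv]
    by (simp add: danger_def)
  also have "\<dots> = card (\<Union>v\<in>D c. B \<inter> star (c, v))"
    using fin by (intro card_UN_disjoint[symmetric]) (auto simp: star_def)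
  also have "\<dots> \<le> card B"
    using fin by (intro card_mono) auto
  also have "\<dots> \<le> b * (2 * k + 2 * n)"
    by (rule inv_B_le[OF inv])
  also have "\<dots> \<le> b * (4 * n)"
    using k(3) by (intro mult_le_mono2) auto
  finally have "real (card (D c) * k) \<le> real (b * (4 * n))"
    by (simp only: of_nat_le_iff)
  then show ?thesis
    using k(1) by (simp add: field_simps)
qed

text \<open>For a single box the potential is its danger, hence at most \<open>lev 1\<close>. By
  \<open>room\<close>, the deferred vertices, \<open>v\<close> itself and the edges Breaker owns at
  the star leave a vertex over.\<close>

lemma deferred_edge:
  assumes inv: "inv M B C A D" and \<beta>: "(c, v) \<in> A"
  obtains u where "u \<in> V - insert v (D c)" "edge c u v \<in> E - B"
proof -
  note fin = inv_finite[OF inv]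
  have v: "v \<in> V"
    using \<beta> inv_sub(3)[OF inv] by auto
  have "real (danger B (c, v)) \<le> lev 1"
    using inv_pot[OF inv, of "{(c, v)}"] \<beta> by (simp add: potential_def split: if_splits)
  then have "real (card (insert v (D c))) + real (danger B (c, v)) < real n"
    using inv_card_deferred[OF inv, of c] room
      card_insert_if[OF fin(5)[of c], of v] by (auto split: if_splits)
  then have "danger B (c, v) < n - card (insert v (D c))"
    by linarith
  also have "n - card (insert v (D c)) = card (V - insert v (D c))"
    using inv_deferred(1)[OF inv, of c] v fin(5)[of c] by (subst card_Diff_subset) auto
  finally have "\<exists>u. u \<in> V - insert v (D c) \<and> edge c u v \<notin> B"
    using danger_ge_card[OF fin(2), of "V - insert v (D c)" c v] by (meson leD)
  then show thesis
    using that v by auto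
qed

text \<open>Maker grows a core while no untreated box exceeds \<open>a\<close>, and treats the most
  dangerous box otherwise. The wanted edge \<open>f\<close> may already be hers, hence the general
  \<open>M'\<close>: she can then claim any other edge. The new \<open>C'\<close>,
  \<open>A'\<close>, \<open>D'\<close> do not depend on Breaker's reply \<open>X\<close>.\<close>

lemma inv_step:
  assumes inv: "inv M B C A D" and A: "A \<noteq> {}"
  obtains f C' A' D' where "f \<in> E - B"
    "\<And>M' X. \<lbrakk>insert f M \<subseteq> M'; M' \<subseteq> E; card M' \<le> Suc (card M); X \<subseteq> E; card X \<le> b\<rbrakk> \<Longrightarrow>
      inv M' (B \<union> X) C' A' D'"
proof -
  note fin = inv_finite[OF inv]
  have finE: "finite X" if "X \<subseteq> E" for X
    using that finite_complete_digraph_edges by (rule finite_subset)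
  have cardA: "card A \<le> 2 * n"
    using card_mono[OF finite_boxes inv_sub(3)[OF inv]] by (simp only: card_boxes)
  have mono: "danger B \<beta> \<le> danger (B \<union> X) \<beta>" if "X \<subseteq> E" for X \<beta>
    using that fin(2) finE by (intro danger_mono) auto
  have cardBX: "card (B \<union> X) \<le> b * Suc t" if "card X \<le> b" "card B \<le> b * t" for X t
    using card_Un_le[of B X] that by simp
  have grow: "(x, y) \<in> (orient c M')\<^sup>*" if "(x, y) \<in> (orient c M)\<^sup>*" "M \<subseteq> M'" for x y c M'
    using that orient_mono by blast
  show thesis
  proof (cases "(\<exists>c. card (C c) < k) \<and> (\<forall>\<beta>\<in>A. danger B \<beta> \<le> a)")
    case True
    then obtain c' where c': "card (C c') < k"
      by blast
    \<comment> \<open>Growing the smaller core keeps the two balanced; if \<open>c'\<close> is the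
      larger one, the other is below \<open>k\<close> as well.\<close>
    obtain c where c: "card (C c) < k" "card (C c) \<le> card (C (\<not> c))"
    proof (cases "card (C c') \<le> card (C (\<not> c'))")
      case True
      with c' that show thesis by blast
    next
      case False
      with c' that[of "\<not> c'"] show thesis by simp
    qed
    obtain u w where uw: "u \<in> C c" "w \<in> V - C c" "edge c u w \<in> E - B"
      using growing_core_edge[OF inv c] .
    define C' where "C' = C(c := insert w (C c))"
    have cardC': "card (C' c) = Suc (card (C c))"
      using uw(2) fin(4)[of c] by (simp add: C'_def)
    have sumC': "card (C' True) + card (C' False) = Suc (card (C True) + card (C False))"
      using cardC' by (cases c) (simp_all add: C'_def)
    have "inv M' (B \<union> X) C' A D"
      if M': "insert (edge c u w) M \<subseteq> M'" "M' \<subseteq> E" "card M' \<le> Suc (card M)"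
        and X: "X \<subseteq> E" "card X \<le> b" for M' X
    proof -
      have core: "1 \<in> C' d \<and> C' d \<subseteq> V \<and> card (C' d) \<le> k \<and> card (C' d) \<le> card (C' (\<not> d)) + 1 \<and>
        (\<forall>w\<in>C' d. (1, w) \<in> (orient d M')\<^sup>*)" for d
      proof -
        have "(1, w) \<in> (orient c M')\<^sup>*"
          using grow[OF inv_core(5)[OF inv uw(1)], of M'] M'(1) by (auto intro: rtrancl_into_rtrancl)
        then have "\<forall>w\<in>C' d. (1, w) \<in> (orient d M')\<^sup>*"
          using inv_core(5)[OF inv, of _ d] grow[of _ _ d M'] M'(1) by (auto simp: C'_def)
        moreover have "card (C' d) \<le> k"
          using inv_core(3)[OF inv, of d] cardC' c(1) by (auto simp: C'_def)
        moreover have "card (C' d) \<le> card (C' (\<not> d)) + 1"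
          using inv_core(4)[OF inv, of d] cardC' c(2) by (cases "d = c") (auto simp: C'_def)
        ultimately show ?thesis
          using inv_core(1,2)[OF inv, of d] uw(2) by (auto simp: C'_def)
      qed
      have deferred: "\<exists>u\<in>V - D d. (u, v) \<in> (orient d M')\<^sup>*" if "v \<in> V" for d v
        using inv_deferred(2)[OF inv that, of d] grow[of _ v d M'] M'(1) by blast
      have joined: "(1, v) \<in> (orient d M')\<^sup>*" if "v \<in> V - D d" "(d, v) \<notin> A" for d v
        using inv_deferred(3)[OF inv that] by (rule grow) (use M'(1) in blast)
      have spent: "k \<le> danger (B \<union> X) (d, v)" if "v \<in> D d" for d v
        using inv_deferred(4)[OF inv that] mono[OF X(1)] by (rule order_trans)
      have pot: "potential j\<^sub>0 (B \<union> X) J \<le> card J * lev (card J)" if J: "J \<subseteq> A" "J \<noteq> {}" for J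
      proof (rule potential_calm[OF finE[OF X(1)] _ X(2) J(2)])
        show "finite J"
          using J(1) fin(3) by (rule finite_subset)
        show "card J \<le> 2 * n"
          using card_mono[OF fin(3) J(1)] cardA by linarith
        show "danger B y \<le> a" if "y \<in> J" for y
          using True that J(1) by blast
      qed
      show ?thesis
      proof (rule invI)
        show "card M' \<le> card (C' True) + card (C' False) + (2 * n - card A)"
          using M'(3) inv_card(1)[OF inv] sumC' by linarith
        show "card (B \<union> X) \<le> b * (card (C' True) + card (C' False) + (2 * n - card A))"
          using cardBX[OF X(2) inv_card(2)[OF inv]] sumC' by simp
        show "B \<union> X \<subseteq> E"
          using X(1) inv_sub(2)[OF inv] by blast
        show "1 \<in> C' d" "C' d \<subseteq> V" "card (C' d) \<le> k" "card (C' d) \<le> card (C' (\<not> d)) + 1"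
          "w \<in> C' d \<Longrightarrow> (1, w) \<in> (orient d M')\<^sup>*" for d w
          using core[of d] by blast+
        show "a \<le> danger (B \<union> X) \<beta>" if "card (C' d) < k" "\<beta> \<in> UNIV \<times> V - A" for d \<beta>
          using inv_growing[OF inv c(1) that(2)] mono[OF X(1), of \<beta>] by linarith
      qed (fact M'(2) inv_sub(3)[OF inv] inv_deferred(1)[OF inv] deferred joined spent pot)+
    qed
    with uw(3) that show thesis by blast
  next
    case False
    obtain \<beta> where \<beta>: "\<beta> \<in> A" "\<And>y. y \<in> A \<Longrightarrow> danger B y \<le> danger B \<beta>"
    proof -
      have "Max (danger B ` A) \<in> danger B ` A"
        using fin(3) A by (intro Max_in) auto
      then obtain \<beta> where "\<beta> \<in> A" "danger B \<beta> = Max (danger B ` A)"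
        by auto
      with that[of \<beta>] fin(3) show thesis by simp
    qed
    obtain c v where cv: "\<beta> = (c, v)"
      by (cases \<beta>)
    have v: "v \<in> V"
      using \<beta>(1) cv inv_sub(3)[OF inv] by auto
    \<comment> \<open>If a core is still unfinished, this case arises only because some untreated
      box exceeds \<open>a\<close>; then so does the maximal one.\<close>
    have hot: "a \<le> danger B \<beta>" if "card (C d) < k" for d
    proof -
      from False that obtain y where "y \<in> A" "a < danger B y"
        by force
      with \<beta>(2)[of y] show ?thesis by linarith
    qed
    define A' where "A' = A - {\<beta>}"
    have cardA': "2 * n - card A' = Suc (2 * n - card A)"
    proof -
      have "card A = Suc (card A')"
        using \<beta>(1) fin(3) unfolding A'_def by (metis card.remove)
      with cardA show ?thesis by simp
    qed
    \<comment> \<open>Common to the three ways of treating the box \<open>(c, v)\<close>: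
      \<open>v\<close> is already reached, \<open>v\<close> is joined to the core, or
      \<open>v\<close> is deferred. Only \<open>D c\<close> may change, and only by
      \<open>v\<close>.\<close>
    have inv': "inv M' (B \<union> X) C A' D'"
      if M': "M \<subseteq> M'" "M' \<subseteq> E" "card M' \<le> Suc (card M)" and X: "X \<subseteq> E" "card X \<le> b"
        and D': "\<And>d. d \<noteq> c \<Longrightarrow> D' d = D d" "D' c \<subseteq> insert v (D c)" "D c \<subseteq> D' c"
          "v \<notin> D' c \<Longrightarrow> (1, v) \<in> (orient c M')\<^sup>*"
          "v \<in> D' c \<Longrightarrow> k \<le> danger B (c, v)"
          "v \<in> D' c \<Longrightarrow> v \<in> D c \<or> (\<exists>u\<in>V - D' c. edge c u v \<in> M')"
      for M' X D'
    proof -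
      have deferred_V: "D' d \<subseteq> V" for d
        using D'(1,2) inv_deferred(1)[OF inv, of d] v by (cases "d = c") auto
      \<comment> \<open>If the starting point of a path gets deferred, it is \<open>v\<close>, and
        the new edge prolongs the path backwards to a vertex that is not deferred. This replaces an
        induction over the order of deferral.\<close>
      have deferred: "\<exists>u\<in>V - D' d. (u, x) \<in> (orient d M')\<^sup>*" if x: "x \<in> V" for d x
      proof -
        obtain u where u: "u \<in> V - D d" "(u, x) \<in> (orient d M')\<^sup>*"
          using inv_deferred(2)[OF inv x, of d] grow[OF _ M'(1)] by blast
        show ?thesis
        proof (cases "u \<in> D' d")
          case True
          have "d = c"
            using D'(1)[of d] True u(1) by blast
          then have ud: "d = c" "u = v"
            using D'(2) True u(1) by blast+
          with True u D'(6) obtain u' where "u' \<in> V - D' c" "edge c u' v \<in> M'"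
            by auto
          moreover from this have "(u', x) \<in> (orient c M')\<^sup>*"
            using u(2) ud by (intro converse_rtrancl_into_rtrancl[of u' v]) auto
          ultimately show ?thesis
            using ud by blast
        qed (use u in auto)
      qed
      have joined: "(1, x) \<in> (orient d M')\<^sup>*" if x: "x \<in> V - D' d" "(d, x) \<notin> A'" for d x
      proof (cases "(d, x) = \<beta>")
        case True
        with x D'(4) cv show ?thesis by auto
      next
        case False
        then have "x \<in> V - D d" "(d, x) \<notin> A"
          using x D'(1)[of d] D'(3) by (cases "d = c"; auto simp: A'_def)+
        then show ?thesis
          using inv_deferred(3)[OF inv] grow[OF _ M'(1)] by blast
      qed
      have spent: "k \<le> danger (B \<union> X) (d, x)" if x: "x \<in> D' d" for d x
      proof -
        have "k \<le> danger B (d, x)"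
        proof (cases "x \<in> D d")
          case True
          then show ?thesis by (rule inv_deferred(4)[OF inv])
        next
          case False
          have "d = c"
            using D'(1)[of d] False x by blast
          then have "d = c" "x = v"
            using D'(2) False x by blast+
          with x D'(5) show ?thesis by simp
        qed
        then show ?thesis
          using mono[OF X(1)] by (rule order_trans)
      qed
      have growing: "a \<le> danger (B \<union> X) y" if "card (C d) < k" "y \<in> UNIV \<times> V - A'" for d y
      proof -
        have "a \<le> danger B y"
          using inv_growing[OF inv that(1), of y] that(2) hot[OF that(1)] by (auto simp: A'_def)
        then show ?thesis
          using mono[OF X(1), of y] by linarith
      qed
      have pot: "potential j\<^sub>0 (B \<union> X) J \<le> card J * lev (card J)" if J: "J \<subseteq> A'" "J \<noteq> {}" for J
      proof -
        have finJ: "finite J"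
          using J(1) fin(3) unfolding A'_def by (meson finite_Diff finite_subset)
        have \<beta>J: "\<beta> \<notin> J" "insert \<beta> J \<subseteq> A"
          using J(1) \<beta>(1) by (auto simp: A'_def)
        have card: "card (insert \<beta> J) = Suc (card J)"
          using finJ \<beta>J(1) by simp
        show ?thesis
        proof (rule potential_treat[OF fin(2) finE[OF X(1)] finJ X(2) J(2) _ \<beta>J(1)])
          show "card J < 2 * n"
            using card_mono[OF fin(3) \<beta>J(2)] cardA card by linarith
          show "danger B y \<le> danger B \<beta>" if "y \<in> J" for y
            using \<beta>(2) that \<beta>J(2) by blast
          show "potential j\<^sub>0 B (insert \<beta> J) \<le> Suc (card J) * lev (Suc (card J))"
            using inv_pot[OF inv \<beta>J(2)] card by simp
        qed
      qed
      show ?thesis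
      proof (rule invI)
        show "card M' \<le> card (C True) + card (C False) + (2 * n - card A')"
          using M'(3) inv_card(1)[OF inv] cardA' by linarith
        show "card (B \<union> X) \<le> b * (card (C True) + card (C False) + (2 * n - card A'))"
          using cardBX[OF X(2) inv_card(2)[OF inv]] cardA' by simp
        show "B \<union> X \<subseteq> E"
          using X(1) inv_sub(2)[OF inv] by blast
        show "A' \<subseteq> UNIV \<times> V"
          using inv_sub(3)[OF inv] by (auto simp: A'_def)
        show "(1, w) \<in> (orient d M')\<^sup>*" if "w \<in> C d" for d w
          using inv_core(5)[OF inv that] M'(1) by (rule grow)
      qed (fact M'(2) inv_core(1-4)[OF inv] deferred_V deferred joined spent growing pot)+
    qed
    show thesis
    proof (cases "(1, v) \<in> (orient c M)\<^sup>*")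
      \<comment> \<open>The box counts as treated without any particular edge; \<open>f\<close> only
        has to be one that Breaker does not own.\<close>
      case True
      obtain f where f: "f \<in> E - B"
        using inv_not_full(2)[OF inv] by blast
      show thesis
      proof (rule that[OF f])
        fix M' X
        assume *: "insert f M \<subseteq> M'" "M' \<subseteq> E" "card M' \<le> Suc (card M)" "X \<subseteq> E" "card X \<le> b"
        then show "inv M' (B \<union> X) C A' D"
          using grow[OF True, of M'] inv_deferred(4)[OF inv] by (intro inv') auto
      qed
    next
      case unreached: False
      show thesis
      proof (cases "\<exists>u\<in>C c. edge c u v \<notin> B")
        case True
        then obtain u where u: "u \<in> C c" "edge c u v \<notin> B"
          by blast
        have "u \<noteq> v" "u \<in> V"
          using inv_core(5)[OF inv u(1)] unreached inv_core(2)[OF inv, of c] u(1) by auto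
        then have f: "edge c u v \<in> E - B"
          using u(2) v by simp
        show thesis
        proof (rule that[OF f])
          fix M' X
          assume *: "insert (edge c u v) M \<subseteq> M'" "M' \<subseteq> E" "card M' \<le> Suc (card M)"
            "X \<subseteq> E" "card X \<le> b"
          have "(1, v) \<in> (orient c M')\<^sup>*"
            using grow[OF inv_core(5)[OF inv u(1)], of M'] *(1) by (auto intro: rtrancl_into_rtrancl)
          with * show "inv M' (B \<union> X) C A' D"
            using inv_deferred(4)[OF inv] by (intro inv') auto
        qed
      next
        case False
        \<comment> \<open>Deferral requires danger \<open>k\<close>: below full core size the
          treated box has danger at least \<open>a \<ge> k\<close>, and at full size Breaker owns
          all \<open>k\<close> edges between the core and \<open>v\<close>.\<close>
        have hot': "k \<le> danger B (c, v)"
        proof (cases "card (C c) < k")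
          case True
          from hot[OF this] k(2) cv show ?thesis by simp
        next
          case False
          moreover have "card (C c) \<le> danger B (c, v)"
            using \<open>\<not> (\<exists>u\<in>C c. edge c u v \<notin> B)\<close> fin(2) by (intro danger_ge_card) auto
          ultimately show ?thesis by linarith
        qed
        obtain u where u: "u \<in> V - insert v (D c)" "edge c u v \<in> E - B"
          using deferred_edge[OF inv] \<beta>(1) cv by blast
        show thesis
        proof (rule that[OF u(2)])
          fix M' X
          assume *: "insert (edge c u v) M \<subseteq> M'" "M' \<subseteq> E" "card M' \<le> Suc (card M)"
            "X \<subseteq> E" "card X \<le> b"
          then show "inv M' (B \<union> X) C A' (D(c := insert v (D c)))"
            using hot' u(1) by (intro inv') auto
        qed
      qed
    qed
  qed
qed

text \<open>Without untreated boxes the root reaches every vertex that is not deferred, and some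
  such vertex reaches \<open>v\<close>.\<close>

lemma inv_done:
  assumes inv: "inv M B C {} D" and v: "v \<in> V"
  shows "(1, v) \<in> (orient c M)\<^sup>*"
proof -
  obtain u where u: "u \<in> V - D c" "(u, v) \<in> (orient c M)\<^sup>*"
    using inv_deferred(2)[OF inv v] by blast
  moreover have "(1, u) \<in> (orient c M)\<^sup>*"
    using inv_deferred(3)[OF inv u(1)] by simp
  ultimately show ?thesis by simp
qed

lemma maker_wins_game: "maker_wins_strong_connectivity n b"
proof -
  \<comment> \<open>The second alternative takes over once Maker has both directions for all
    vertices; from then on any edge will do.\<close>
  define I where "I M B \<longleftrightarrow> M \<subseteq> E \<and> ((\<exists>C A D. inv M B C A D) \<or>
    (\<forall>c. \<forall>v\<in>V. (1, v) \<in> (orient c M)\<^sup>*))" for M B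
  have "maker_wins E b (\<lambda>A. strongly_connected (digraph_on n A))"
  proof (rule maker_wins_by_invariant[where I = I, OF finite_complete_digraph_edges b(1)])
    show "I {} {}"
      unfolding I_def using inv_init by blast
  next
    fix M B
    assume I: "I M B" and free: "E - (M \<union> B) \<noteq> {}"
    show "\<exists>e\<in>E - (M \<union> B). \<forall>X. X \<subseteq> E - (M \<union> B) - {e} \<and> card X \<le> b \<longrightarrow> I (insert e M) (B \<union> X)"
    proof (cases "\<forall>c. \<forall>v\<in>V. (1, v) \<in> (orient c M)\<^sup>*")
      case True
      from free obtain e where e: "e \<in> E - (M \<union> B)"
        by blast
      have "(1, v) \<in> (orient c (insert e M))\<^sup>*" if "v \<in> V" for c v
        using True that orient_mono[of M "insert e M" c] by blast
      then have "I (insert e M) B'" for B'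
        using e I by (auto simp: I_def)
      with e show ?thesis by blast
    next
      case False
      with I obtain C A D where inv: "inv M B C A D"
        unfolding I_def by blast
      have "A \<noteq> {}"
        using False inv_done inv by blast
      then obtain f C' A' D' where f: "f \<in> E - B" and
        next_inv: "\<And>M' X. \<lbrakk>insert f M \<subseteq> M'; M' \<subseteq> E; card M' \<le> Suc (card M); X \<subseteq> E; card X \<le> b\<rbrakk> \<Longrightarrow>
          inv M' (B \<union> X) C' A' D'"
        using inv_step[OF inv] by metis
      obtain e where e: "e \<in> E - (M \<union> B)" "f \<in> insert e M"
      proof (cases "f \<in> M")
        case True
        from free obtain e where "e \<in> E - (M \<union> B)"
          by blast
        with True that show thesis by blast
      next
        case False
        with f that[of f] show thesis by blast
      qed
      have "I (insert e M) (B \<union> X)" if "X \<subseteq> E - (M \<union> B) - {e}" "card X \<le> b" for X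
      proof -
        have "inv (insert e M) (B \<union> X) C' A' D'"
          by (rule next_inv) (use e that inv_sub(1)[OF inv] in \<open>auto simp: card_insert_if inv_finite(1)[OF inv]\<close>)
        then show ?thesis
          using inv_sub(1) unfolding I_def by blast
      qed
      with e(1) show ?thesis by blast
    qed
  next
    fix M B
    assume I: "I M B" and full: "E \<subseteq> M \<union> B"
    \<comment> \<open>On a full board the edge count rules out the first alternative of
      \<open>I\<close>, so the second one holds.\<close>
    have "\<not> inv M B C A D" for C A D
    proof
      assume inv: "inv M B C A D"
      have "card E \<le> card (M \<union> B)"
        using full inv_finite(1,2)[OF inv] by (intro card_mono) auto
      also have "\<dots> \<le> card M + card B"
        by (rule card_Un_le)
      finally show False
        using inv_not_full(1)[OF inv] by simp
    qed
    then show "strongly_connected (digraph_on n M)"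
      using I n unfolding I_def by (intro strongly_connected_if_root) auto
  qed
  then show ?thesis
    by (simp add: maker_wins_strong_connectivity_def)
qed

end

section \<open>The threshold\<close>

text \<open>The summand 1 pays for the first term; each further one satisfies
  \<open>1 / (N + 1) \<le> ln ((N + 1) / N)\<close>.\<close>

lemma sum_inverse_le_ln:
  fixes m N :: nat
  assumes "m \<ge> 1" "m \<le> N"
  shows "(\<Sum>i=m..N. 1 / real i) \<le> 1 + ln (real N / real m)"
  using assms(2)
proof (induction N rule: dec_induct)
  case base
  then show ?case using assms(1) by simp
next
  case (step N)
  have N: "real N > 0"
    using step(1) assms(1) by simp
  have "ln (real N / real (Suc N)) \<le> real N / real (Suc N) - 1"
    using N by (intro ln_le_minus_one) simp
  also have "\<dots> = - (1 / real (Suc N))"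
    by (simp add: field_simps)
  finally have "1 / real (Suc N) \<le> ln (real (Suc N) / real N)"
    using N by (simp add: ln_div)
  moreover have "ln (real (Suc N) / real m) = ln (real N / real m) + ln (real (Suc N) / real N)"
    using N assms(1) by (simp add: ln_div)
  ultimately show ?case
    using step by simp
qed

text \<open>The doubled bias is paid only on sizes from \<open>j\<^sub>0\<close> to
  \<open>N\<close>, where the harmonic sum is about \<open>ln (N / j\<^sub>0)\<close>.\<close>

lemma level_one_le:
  assumes "j\<^sub>0 \<ge> 1" "j\<^sub>0 \<le> N"
  shows "level j\<^sub>0 b N a 1 \<le> a + real j\<^sub>0 + real b * (1 + ln (real j\<^sub>0)) + 2 * real b * (1 + ln (real N / real j\<^sub>0))"
proof -
  have "{1..N} = {1..<j\<^sub>0} \<union> {j\<^sub>0..N}"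
    using assms by auto
  then have "(\<Sum>i=1..N. weight j\<^sub>0 b i) = (\<Sum>i\<in>{1..<j\<^sub>0}. weight j\<^sub>0 b i) + (\<Sum>i\<in>{j\<^sub>0..N}. weight j\<^sub>0 b i)"
    by (simp add: sum.union_disjoint ivl_disj_int)
  also have "(\<Sum>i\<in>{1..<j\<^sub>0}. weight j\<^sub>0 b i) = (\<Sum>i\<in>{1..<j\<^sub>0}. 1 + real b * (1 / real i))"
    by (rule sum.cong) (auto simp: weight_def)
  also have "\<dots> \<le> (\<Sum>i\<in>{1..j\<^sub>0}. 1 + real b * (1 / real i))"
    by (intro sum_mono2) auto
  also have "\<dots> = real j\<^sub>0 + real b * (\<Sum>i=1..j\<^sub>0. 1 / real i)"
    by (simp add: sum.distrib sum_distrib_left)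
  also have "\<dots> \<le> real j\<^sub>0 + real b * (1 + ln (real j\<^sub>0))"
    using sum_inverse_le_ln[of 1 j\<^sub>0] assms(1) by (intro add_left_mono mult_left_mono) auto
  also have "(\<Sum>i\<in>{j\<^sub>0..N}. weight j\<^sub>0 b i) = (\<Sum>i\<in>{j\<^sub>0..N}. 2 * real b * (1 / real i))"
    by (rule sum.cong) (auto simp: weight_def)
  also have "\<dots> = 2 * real b * (\<Sum>i=j\<^sub>0..N. 1 / real i)"
    by (simp add: sum_distrib_left)
  also have "\<dots> \<le> 2 * real b * (1 + ln (real N / real j\<^sub>0))"
    using sum_inverse_le_ln[OF assms] by (intro mult_left_mono) auto
  finally show ?thesis
    by (simp add: level_def)
qed

text \<open>The parameters are \<open>a = \<eta> * n\<close>, \<open>k\<close> its floor and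
  \<open>j\<^sub>0\<close> the ceiling of \<open>t n = n / ln n\<close>. The main term of
  \<open>lev 1\<close> is \<open>b ln n\<close>, at most \<open>(1 - \<epsilon>) * n\<close>;
  \<open>a\<close> and the lower-order terms take at most \<open>\<eta> * n\<close> each, which fits
  because \<open>4 * \<eta> \<le> \<epsilon>\<close>.\<close>

lemma maker_wins_eventually:
  fixes \<epsilon> :: real
  assumes "\<epsilon> > 0"
  shows "\<forall>\<^sub>F n :: nat in sequentially. \<forall>b :: nat. b \<ge> 1 \<longrightarrow>
    real b \<le> (1 - \<epsilon>) * real n / ln (real n) \<longrightarrow> maker_wins_strong_connectivity n b"
proof -
  define \<eta> where "\<eta> = min (\<epsilon> / 4) (1 / 4)"
  have \<eta>: "\<eta> > 0" "\<eta> \<le> 1 / 4" "\<eta> \<le> \<epsilon> / 4"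
    using assms by (auto simp: \<eta>_def)
  define t where "t = (\<lambda>n. real n / ln (real n))"
  have "\<forall>\<^sub>F n :: nat in sequentially. \<eta> * real n \<ge> 2"
    using \<eta>(1) by real_asymp
  moreover have "\<forall>\<^sub>F n :: nat in sequentially. t n + 1 \<le> \<eta> * real n / 4"
    unfolding t_def using \<eta>(1) by real_asymp
  moreover have "\<forall>\<^sub>F n :: nat in sequentially. (t n + 1) * (4 * real n) < real n * (real n - 1)"
    unfolding t_def by real_asymp
  moreover have "\<forall>\<^sub>F n :: nat in sequentially. t n \<ge> 1 \<and> ln (real n) \<ge> 1"
    unfolding t_def by (intro eventually_conj; real_asymp)
  moreover have "\<forall>\<^sub>F n :: nat in sequentially.
      8 * t n / \<eta> + 2 + 2 * t n + 2 * t n * (1 + ln (2 * ln (real n))) < \<eta> * real n"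
    unfolding t_def using \<eta>(1) by real_asymp
  ultimately show ?thesis
    using eventually_ge_at_top[of 2]
  proof eventually_elim
    case (elim n)
    show ?case
    proof (intro allI impI)
      fix b :: nat
      assume b: "b \<ge> 1" "real b \<le> (1 - \<epsilon>) * real n / ln (real n)"
      define a where "a = \<eta> * real n"
      define k where "k = nat \<lfloor>a\<rfloor>"
      define j\<^sub>0 where "j\<^sub>0 = nat \<lceil>t n\<rceil>"
      have bt: "real b \<le> (1 - \<epsilon>) * t n"
        using b(2) by (simp add: t_def)
      also have "\<dots> \<le> 1 * t n"
        using assms elim(4) by (intro mult_right_mono) auto
      finally have bt': "real b \<le> t n" by simp
      have kk: "real k \<le> a" "a / 2 \<le> real k"
        using elim(1) unfolding k_def a_def by linarith+
      have a: "a \<le> real n / 4" "a \<ge> 2"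
        using mult_right_mono[OF \<eta>(2), of "real n"] elim(1) by (simp_all add: a_def)
      have k1: "k \<ge> 1"
        using kk(2) a(2) by linarith
      have b4: "4 * real b \<le> a"
        using elim(2) bt' by (simp add: a_def)
      have j: "t n \<le> real j\<^sub>0" "real j\<^sub>0 \<le> t n + 1"
        using elim(4) unfolding j\<^sub>0_def by linarith+
      have j1: "j\<^sub>0 \<ge> 1"
        using j(1) elim(4) by linarith
      have "t n \<le> real n"
        using elim(2) a by (simp add: a_def)
      then have jn: "j\<^sub>0 \<le> n"
        unfolding j\<^sub>0_def by linarith
      have "level j\<^sub>0 b (2 * n) a 1 \<le> a + real j\<^sub>0 + real b * (1 + ln (real j\<^sub>0)) +
          2 * real b * (1 + ln (real (2 * n) / real j\<^sub>0))"
        by (rule level_one_le) (use j1 jn in auto)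
      also have "\<dots> \<le> \<eta> * real n + (t n + 1) + (t n + (1 - \<epsilon>) * real n) +
          2 * t n * (1 + ln (2 * ln (real n)))"
      proof -
        have "ln (real j\<^sub>0) \<le> ln (real n)"
          using j1 jn by simp
        then have "real b * (1 + ln (real j\<^sub>0)) \<le> real b * (1 + ln (real n))"
          by (intro mult_left_mono) auto
        also have "\<dots> = real b + real b * ln (real n)"
          by (simp add: algebra_simps)
        also have "real b * ln (real n) \<le> (1 - \<epsilon>) * real n"
          using b(2) elim(4) by (simp add: field_simps)
        finally have 1: "real b * (1 + ln (real j\<^sub>0)) \<le> t n + (1 - \<epsilon>) * real n"
          using bt' by linarith
        \<comment> \<open>Since \<open>j\<^sub>0 \<ge> n / ln n\<close>, the range with doubled bias
          contributes only a multiple of \<open>b ln ln n\<close>.\<close>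
        have "real (2 * n) / real j\<^sub>0 \<le> real (2 * n) / t n"
          using j(1) elim(4) by (intro divide_left_mono) auto
        also have "\<dots> = 2 * ln (real n)"
          using elim(4,6) by (simp add: t_def)
        finally have "ln (real (2 * n) / real j\<^sub>0) \<le> ln (2 * ln (real n))"
          using elim(6) j1 elim(4) by (subst ln_le_cancel_iff) auto
        moreover have "0 \<le> ln (2 * ln (real n))"
          using elim(4) by simp
        ultimately have 2: "2 * real b * (1 + ln (real (2 * n) / real j\<^sub>0)) \<le>
            2 * t n * (1 + ln (2 * ln (real n)))"
          using bt' elim(4) by (intro order_trans[OF mult_left_mono mult_right_mono]) auto
        show ?thesis
          using 1 2 j(2) by (simp add: a_def)
      qed
      finally have lev: "level j\<^sub>0 b (2 * n) a 1 \<le> \<dots>" .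
      have "4 * real b * real n / real k \<le> 4 * t n * real n / (a / 2)"
        using bt' kk(2) a(2) k1 by (intro frac_le mult_right_mono) auto
      also have "\<dots> = 8 * t n / \<eta>"
        using elim(6) \<eta>(1) by (simp add: a_def)
      finally have room: "4 * real b * real n / real k \<le> 8 * t n / \<eta>" .
      have "4 * (\<eta> * real n) \<le> \<epsilon> * real n"
        using \<eta>(3) elim(6) by simp
      then have room': "4 * real b * real n / real k + 1 + level j\<^sub>0 b (2 * n) a 1 < real n"
        using room lev elim(1,5) by (simp add: algebra_simps)
      have "maker_strategy n b k j\<^sub>0 a"
      proof
        show "n \<ge> 2" "k \<ge> 1" "real k \<le> a" "b \<ge> 1" "4 * real b \<le> a"
          by fact+
        show "k \<le> n" "k + 6 * b < n"
          using kk(1) a b4 by linarith+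
        have "(real b + 1) * (2 * real k + 2 * real n) \<le> (t n + 1) * (4 * real n)"
          using bt' kk(1) a elim(4) by (intro mult_mono) auto
        also have "\<dots> < real n * (real n - 1)"
          by (rule elim(3))
        finally have "real ((b + 1) * (2 * k + 2 * n)) < real (n * (n - 1))"
          using elim(6) by (simp add: of_nat_diff algebra_simps)
        then show "(b + 1) * (2 * k + 2 * n) < n * (n - 1)"
          by (simp only: of_nat_less_iff)
        show "4 * real b * real n / real k + 1 + level j\<^sub>0 b (2 * n) a 1 < real n"
          by (rule room')
      qed
      then show "maker_wins_strong_connectivity n b"
        by (rule maker_strategy.maker_wins_game)
    qed
  qed
qed

theorem theorem1:
  fixes \<epsilon> :: real
  assumes "\<epsilon> > 0"
  shows "\<exists>n\<^sub>\<epsilon>::nat. \<forall>n\<ge>n\<^sub>\<epsilon>. \<forall>b::nat. b \<ge> 1 \<longrightarrow>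
    (real b \<ge> (1 + \<epsilon>) * real n / ln (real n) \<longrightarrow> breaker_wins_strong_connectivity n b) \<and>
    (real b \<le> (1 - \<epsilon>) * real n / ln (real n) \<longrightarrow> maker_wins_strong_connectivity n b)"
proof -
  have "\<forall>\<^sub>F n :: nat in sequentially. \<forall>b::nat. b \<ge> 1 \<longrightarrow>
    (real b \<ge> (1 + \<epsilon>) * real n / ln (real n) \<longrightarrow> breaker_wins_strong_connectivity n b) \<and>
    (real b \<le> (1 - \<epsilon>) * real n / ln (real n) \<longrightarrow> maker_wins_strong_connectivity n b)"
    using breaker_wins_eventually[OF assms] maker_wins_eventually[OF assms]
    by eventually_elim blast
  then show ?thesis
    by (simp only: eventually_sequentially)
qed

end
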